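(* Let $A\in\mathbb{C}^{m\times m}$, $B_i\in\mathbb{C}^{m\times q_i}$, $C_i\in\mathbb{C}^{r_i\times m}$ for $1\le i\le v$, and let $\lambda\in\mathbb{C}$. Let $G_{cn}(z,K)=zI-A-B_1K_1C_1-\cdots-B_vK_vC_v$, where the entries of the $q_i\times r_i$ matrices $K_i$ are distinct independent indeterminates, and let $\mathcal{N}_{cn}(\lambda)$ be the LTI network over $\mathbb{C}$ with channel matrices $H_{tx,rx}=\lambda I-A$, $H_{tx,i}=C_i$, $H_{i,rx}=-B_i$, $H_{i,j}=0$ for $1\le i,j\le v$. The following statements are equivalent. (1) $\lambda$ is a fixed mode of the decentralized linear system $\mathcal{L}(A,B_i,C_i)$. (2) $\operatorname{rank}\,G_{cn}(\lambda,K)<\dim(A)$. (3) The rank of the transfer matrix of the LTI network $\mathcal{N}_{cn}(\lambda)$ is less than $\dim(A)$. (4) The mincut rank of the LTI network $\mathcal{N}_{cn}(\lambda)$ is less than $\dim(A)$. (5) $\displaystyle\min_{V\subseteq\{1,\dots,v\}}\operatorname{rank}\begin{bmatrix}\lambda I-A&-B_V\\ C_{V^c}&0\end{bmatrix}<\dim(A)$.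
   Context: The decentralized linear system $\mathcal{L}(A,B_i,C_i)$ is $x[n+1]=Ax[n]+\sum_{i=1}^vB_iu_i[n]$, $y_i[n]=C_ix[n]$ ($1\le i\le v$). $\lambda\in\mathbb{C}$ is a fixed mode of it if $\lambda\in\bigcap_{K_i\in\mathbb{C}^{q_i\times r_i}}\sigma\big(A+\sum_{i=1}^vB_iK_iC_i\big)$, where $\sigma(\cdot)$ is the set of eigenvalues. $\dim(A)=m$. LTI network over $\mathbb{C}$ (at a fixed frequency): nodes $tx$, relays $1,\dots,v$, $rx$; constant complex channel matrices $H_{i,j}$ from $i\in\{tx,1,\dots,v\}$ to $j\in\{1,\dots,v,rx\}$; relay $i$ applies gain matrix $K_i$ with distinct independent indeterminate entries (collectively $K$). Its transfer matrix is $H_{tx,rx}+[H_{1,rx}K_1\ \cdots\ H_{v,rx}K_v]\,(I-[H_{j,i}K_j]_{i,j=1}^v)^{-1}\,[H_{tx,1};\dots;H_{tx,v}]$ (in $[H_{j,i}K_j]_{i,j}$ the block in block row $i$, block column $j$ is $H_{j,i}K_j$; $[\,\cdot\,;\cdot\,]$ is vertical stacking), with rank taken over $\mathbb{C}(K)$. Its mincut rank is the minimum over all $W\subseteq\{tx,1,\dots,v,rx\}$ with $tx\in W$, $rx\notin W$ of $\operatorname{rank}H_{W,W^c}$, where $H_{W,W^c}$ has block rows $j\in W^c$, block columns $i\in W$, and $(j,i)$ block $H_{i,j}$. For $V\subseteq\{1,\dots,v\}$, $V^c=\{1,\dots,v\}\setminus V$, $B_V$ is the horizontal concatenation of $B_i$,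 $i\in V$, and $C_{V^c}$ the vertical concatenation of $C_i$, $i\in V^c$. The rank in (2) is over $\mathbb{C}(K)$. *)

theory Defs
  imports
    "HOL-Library.Poly_Mapping"
    "HOL-Library.Nat_Bijection"
    "HOL-Computational_Algebra.Fraction_Field"
    "Jordan_Normal_Form.Gauss_Jordan_Elimination"
    "Jordan_Normal_Form.Spectral_Radius"
    "Jordan_Normal_Form.DL_Rank"
begin

section \<open>Matrices\<close>

definition mrank :: "'a :: field mat \<Rightarrow> nat" where
  "mrank M = vec_space.rank (dim_row M) M"

text \<open>Matrices do not form a \<open>comm_monoid_add\<close> (the zero depends on the format), so
  the format is passed explicitly.\<close>

definition mat_sum :: "nat \<Rightarrow> nat \<Rightarrow> ('i \<Rightarrow> 'a :: comm_monoid_add mat) \<Rightarrow> 'i set \<Rightarrow> 'a mat" where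
  "mat_sum nr nc f S = mat nr nc (\<lambda>(a, b). \<Sum>i\<in>S. f i $$ (a, b))"

definition append_cols :: "'a :: zero mat \<Rightarrow> 'a mat \<Rightarrow> 'a mat" where
  "append_cols M N = four_block_mat M N (0\<^sub>m 0 (dim_col M)) (0\<^sub>m 0 (dim_col N))"

text \<open>The first argument of \<open>hcat\<close> (\<open>vcat\<close>) is the common number of rows (columns); it
  matters only for the empty list.\<close>

definition hcat :: "nat \<Rightarrow> 'a :: zero mat list \<Rightarrow> 'a mat" where
  "hcat nr Ms = foldr append_cols Ms (0\<^sub>m nr 0)"

definition vcat :: "nat \<Rightarrow> 'a :: zero mat list \<Rightarrow> 'a mat" where
  "vcat nc Ms = foldr append_rows Ms (0\<^sub>m 0 nc)"

text \<open>The block in block row \<open>j\<close> and block column \<open>i\<close> is \<open>F j i\<close>, of format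
  \<open>rd j \<times> cd i\<close>.\<close>

definition block_mat ::
  "('i \<Rightarrow> nat) \<Rightarrow> ('j \<Rightarrow> nat) \<Rightarrow> 'i list \<Rightarrow> 'j list \<Rightarrow> ('i \<Rightarrow> 'j \<Rightarrow> 'a :: zero mat) \<Rightarrow> 'a mat" where
  "block_mat rd cd js is F =
     vcat (\<Sum>i\<leftarrow>is. cd i) (map (\<lambda>j. hcat (rd j) (map (\<lambda>i. F j i) is)) js)"

section \<open>The field of rational functions in the gain entries\<close>

text \<open>Polynomials over the complex numbers in countably many indeterminates (a monomial is a
  finitely supported exponent function), and their field of fractions. The rank of a matrix
  does not depend on the presence of further indeterminates.\<close>

type_synonym cpoly = "(nat \<Rightarrow>\<^sub>0 nat) \<Rightarrow>\<^sub>0 complex"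
type_synonym crat = "cpoly fract"

definition const_rat :: "complex \<Rightarrow> crat" where
  "const_rat c = Fract (Poly_Mapping.single 0 c) 1"

definition indet :: "nat \<Rightarrow> crat" where
  "indet x = Fract (Poly_Mapping.single (Poly_Mapping.single x 1) 1) 1"

abbreviation const_mat :: "complex mat \<Rightarrow> crat mat" where
  "const_mat \<equiv> map_mat const_rat"

text \<open>The matrix \<open>K\<^sub>i\<close>. Since \<open>prod_encode\<close> is injective, all entries of all these matrices
  are distinct indeterminates.\<close>

definition gain :: "nat \<Rightarrow> nat \<Rightarrow> nat \<Rightarrow> crat mat" where
  "gain nr nc i = mat nr nc (\<lambda>(a, b). indet (prod_encode (i, prod_encode (a, b))))"

section \<open>Decentralized linear systems\<close>

text \<open>In the system with state dimension \<open>m\<close> and channels \<open>1, \<dots>, v\<close>, the input \<open>u\<^sub>i\<close> has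
  dimension \<open>q i\<close> and the output \<open>y\<^sub>i\<close> has dimension \<open>r i\<close>.\<close>

definition fixed_mode ::
  "nat \<Rightarrow> nat \<Rightarrow> (nat \<Rightarrow> nat) \<Rightarrow> (nat \<Rightarrow> nat) \<Rightarrow>
   complex mat \<Rightarrow> (nat \<Rightarrow> complex mat) \<Rightarrow> (nat \<Rightarrow> complex mat) \<Rightarrow> complex \<Rightarrow> bool" where
  "fixed_mode m v q r A B C l \<longleftrightarrow>
     l \<in> (\<Inter>K \<in> {K. \<forall>i\<in>{1..v}. K i \<in> carrier_mat (q i) (r i)}.
            spectrum (A + mat_sum m m (\<lambda>i. B i * K i * C i) {1..v}))"

definition G_cn ::
  "nat \<Rightarrow> nat \<Rightarrow> (nat \<Rightarrow> nat) \<Rightarrow> (nat \<Rightarrow> nat) \<Rightarrow>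
   complex mat \<Rightarrow> (nat \<Rightarrow> complex mat) \<Rightarrow> (nat \<Rightarrow> complex mat) \<Rightarrow> crat \<Rightarrow> crat mat" where
  "G_cn m v q r A B C z =
     z \<cdot>\<^sub>m 1\<^sub>m m - const_mat A
       - mat_sum m m (\<lambda>i. const_mat (B i) * gain (q i) (r i) i * const_mat (C i)) {1..v}"

section \<open>LTI networks\<close>

datatype node = Tx | Relay nat | Rx

text \<open>\<open>out_dim n\<close> and \<open>in_dim n\<close> are the dimensions of the signals transmitted and received
  by \<open>n\<close>; \<open>channel N i j\<close> is the channel matrix from \<open>i\<close> to \<open>j\<close>, of format
  \<open>in_dim N j \<times> out_dim N i\<close>.\<close>

record lti_network =
  num_relays :: nat
  out_dim :: "node \<Rightarrow> nat"
  in_dim :: "node \<Rightarrow> nat"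
  channel :: "node \<Rightarrow> node \<Rightarrow> complex mat"

definition relay_list :: "lti_network \<Rightarrow> node list" where
  "relay_list N = map Relay [1..<Suc (num_relays N)]"

definition node_list :: "lti_network \<Rightarrow> node list" where
  "node_list N = Tx # relay_list N @ [Rx]"

fun relay_gain :: "lti_network \<Rightarrow> node \<Rightarrow> crat mat" where
  "relay_gain N (Relay i) = gain (out_dim N (Relay i)) (in_dim N (Relay i)) i"
| "relay_gain N n = 0\<^sub>m (out_dim N n) (in_dim N n)"

definition relay_loop :: "lti_network \<Rightarrow> crat mat" where
  "relay_loop N = block_mat (in_dim N) (in_dim N) (relay_list N) (relay_list N)
     (\<lambda>i j. const_mat (channel N j i) * relay_gain N j)"

text \<open>For channel matrices of the right formats the matrix inverted here is nonsingular, so that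
  \<open>mat_inverse\<close> is not \<open>None\<close>: its determinant is a polynomial in the
  gain entries with constant term 1.\<close>

definition transfer_matrix :: "lti_network \<Rightarrow> crat mat" where
  "transfer_matrix N =
     const_mat (channel N Tx Rx)
     + hcat (in_dim N Rx) (map (\<lambda>i. const_mat (channel N i Rx) * relay_gain N i) (relay_list N))
       * the (mat_inverse (1\<^sub>m (dim_row (relay_loop N)) - relay_loop N))
       * vcat (out_dim N Tx) (map (\<lambda>i. const_mat (channel N Tx i)) (relay_list N))"

definition cut_matrix :: "lti_network \<Rightarrow> node set \<Rightarrow> complex mat" where
  "cut_matrix N W = block_mat (in_dim N) (out_dim N)
     (filter (\<lambda>j. j \<notin> W) (node_list N)) (filter (\<lambda>i. i \<in> W) (node_list N))
     (\<lambda>j i. channel N i j)"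

definition mincut_rank :: "lti_network \<Rightarrow> nat" where
  "mincut_rank N =
     Min ((\<lambda>W. mrank (cut_matrix N W)) ` {W. W \<subseteq> set (node_list N) \<and> Tx \<in> W \<and> Rx \<notin> W})"

text \<open>Channels into \<open>Tx\<close> or out of \<open>Rx\<close> do not exist and are never inspected; they are given
  dimension 0.\<close>

definition N_cn ::
  "nat \<Rightarrow> nat \<Rightarrow> (nat \<Rightarrow> nat) \<Rightarrow> (nat \<Rightarrow> nat) \<Rightarrow>
   complex mat \<Rightarrow> (nat \<Rightarrow> complex mat) \<Rightarrow> (nat \<Rightarrow> complex mat) \<Rightarrow> complex \<Rightarrow> lti_network" where
  "N_cn m v q r A B C l =
     (let od = (\<lambda>n. case n of Tx \<Rightarrow> m | Relay i \<Rightarrow> q i | Rx \<Rightarrow> 0);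
          idim = (\<lambda>n. case n of Tx \<Rightarrow> 0 | Relay i \<Rightarrow> r i | Rx \<Rightarrow> m)
      in \<lparr> num_relays = v, out_dim = od, in_dim = idim,
           channel = (\<lambda>i j. case (i, j) of
               (Tx, Rx) \<Rightarrow> l \<cdot>\<^sub>m 1\<^sub>m m - A
             | (Tx, Relay k) \<Rightarrow> C k
             | (Relay k, Rx) \<Rightarrow> - B k
             | _ \<Rightarrow> 0\<^sub>m (idim j) (od i)) \<rparr>)"

section \<open>The matrix pencil test\<close>

text \<open>\<open>sub_B\<close> and \<open>sub_C\<close> concatenate the \<open>B i\<close> and \<open>C i\<close> with \<open>i\<close> in the index set, in
  increasing order.\<close>

definition sub_B :: "nat \<Rightarrow> (nat \<Rightarrow> complex mat) \<Rightarrow> nat set \<Rightarrow> complex mat" where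
  "sub_B m B V = hcat m (map B (sorted_list_of_set V))"

definition sub_C :: "nat \<Rightarrow> (nat \<Rightarrow> complex mat) \<Rightarrow> nat set \<Rightarrow> complex mat" where
  "sub_C m C V = vcat m (map C (sorted_list_of_set V))"

definition pencil ::
  "nat \<Rightarrow> nat \<Rightarrow> complex mat \<Rightarrow> (nat \<Rightarrow> complex mat) \<Rightarrow> (nat \<Rightarrow> complex mat) \<Rightarrow>
   complex \<Rightarrow> nat set \<Rightarrow> complex mat" where
  "pencil m v A B C l V =
     (let BV = sub_B m B V; CV = sub_C m C ({1..v} - V)
      in four_block_mat (l \<cdot>\<^sub>m 1\<^sub>m m - A) (- BV) CV (0\<^sub>m (dim_row CV) (dim_col BV)))"

end

theory Submission
  imports Defs
begin

text \<open>
  Let \<open>M = \<lambda>I - A\<close>. Statements (3) and (4) are reformulations of (2) and (5): as there are no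
  relay-to-relay channels, the transfer matrix is \<open>G\<^sub>c\<^sub>n\<close> itself, and the cut matrices are the
  pencils up to a swap of block rows.

  (5) implies (2) since \<open>G\<^sub>c\<^sub>n\<close> is the product of \<open>[I, X]\<close>, the pencil of any \<open>V\<close> and \<open>[I; Y]\<close> for
  suitable \<open>X\<close> and \<open>Y\<close>, and extending the scalars does not increase the rank. (2) implies (1) by
  evaluating the polynomial \<open>det G\<^sub>c\<^sub>n\<close> at complex gains.

  For (1) implies (5), assume that all pencils have rank at least \<open>m\<close>. The entries of the gain
  matrices are fixed one after another, as scalar gains of rank-one terms \<open>b c\<^sup>T\<close>: if both
  \<open>P + b x\<^sup>T\<close> and \<open>P + y c\<^sup>T\<close> have rank at least \<open>m\<close>, then so has \<open>P + t b c\<^sup>T\<close> for all but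
  finitely many \<open>t\<close>. With \<open>x\<close> and \<open>y\<close> unit vectors that mark border columns and rows, this
  preserves the rank condition on all the remaining bordered matrices, until an invertible
  \<open>M - \<Sigma> B\<^sub>i K\<^sub>i C\<^sub>i\<close> is left.
\<close>

subsection \<open>Rank and factorizations\<close>

text \<open>Padding \<open>R\<close> with zero rows to a \<open>d \<times> d\<close> matrix keeps
  its kernel and forces the determinant to vanish.\<close>

lemma wide_kernel_nonzero:
  fixes R :: "'a :: field mat"
  assumes R: "R \<in> carrier_mat k d" and "k < d"
  shows "\<exists>v \<in> carrier_vec d. v \<noteq> 0\<^sub>v d \<and> R *\<^sub>v v = 0\<^sub>v k"
proof -
  \<comment> \<open>Row \<open>k\<close>, the first padding row, has a branch of its own because
    \<open>det_row_0\<close> expects one distinguished zero row.\<close>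
  let ?P = "mat\<^sub>r d d (\<lambda>i. if i = k then 0\<^sub>v d else if i < k then row R i else 0\<^sub>v d)"
  have "det ?P = 0"
    using assms by (intro det_row_0) (auto intro: row_carrier_vec)
  then obtain v where v: "v \<in> carrier_vec d" "v \<noteq> 0\<^sub>v d" and Pv: "?P *\<^sub>v v = 0\<^sub>v d"
    using det_0_iff_vec_prod_zero_field[of ?P d] by auto
  have "R *\<^sub>v v = 0\<^sub>v k"
  proof (rule eq_vecI)
    fix i assume "i < dim_vec (0\<^sub>v k :: 'a vec)"
    then have i: "i < k" by simp
    have "(?P *\<^sub>v v) $ i = row R i \<bullet> v"
      using i \<open>k < d\<close> R by (auto simp: row_mat_of_row_fun)
    with Pv i \<open>k < d\<close> R show "(R *\<^sub>v v) $ i = (0\<^sub>v k :: 'a vec) $ i" by simp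
  qed (use R in auto)
  with v show ?thesis by blast
qed

context vec_space
begin

text \<open>The columns of \<open>L\<close> form a maximal independent set of columns of
  \<open>M\<close>, and \<open>R\<close> holds the coordinates of all columns of \<open>M\<close> in
  this basis.\<close>

lemma rank_factorization:
  assumes M: "M \<in> carrier_mat n nc"
  shows "\<exists>L \<in> carrier_mat n (rank M). \<exists>R \<in> carrier_mat (rank M) nc. M = L * R"
proof -
  let ?P = "\<lambda>T. T \<subseteq> set (cols M) \<and> lin_indpt T"
  obtain S where max: "maximal S ?P"
    using maximal_exists[of ?P "card (set (cols M))" "{}"]
    by (meson List.finite_set card_mono empty_iff empty_subsetI finite_lin_indpt2 rev_finite_subset)
  have S: "S \<subseteq> set (cols M)" "lin_indpt S" using max by (auto simp: maximal_def)
  have colsM: "set (cols M) \<subseteq> carrier_vec n" using cols_dim M by blast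
  have Sn: "S \<subseteq> carrier_vec n" using S colsM by blast
  have fin: "finite S" using S finite_subset by blast
  have rk: "rank M = card S" using rank_card_indpt[OF M max] .
  have in_span: "s \<in> span S" if s: "s \<in> set (cols M)" for s
  proof (rule ccontr)
    assume ns: "s \<notin> span S"
    then have "s \<notin> S" using Sn span_mem by auto
    have "lin_indpt (insert s S)"
      using lin_dep_iff_in_span[OF _ S(2), of s] Sn colsM s ns \<open>s \<notin> S\<close> by auto
    then show False using max s S \<open>s \<notin> S\<close> unfolding maximal_def by blast
  qed
  obtain ss where ss: "set ss = S" "distinct ss" using fin finite_distinct_list by blast
  then have len: "length ss = rank M" using rk distinct_card by fastforce
  have "\<exists>a. col M j = lincomb a S" if "j < nc" for j
  proof -
    have "col M j \<in> set (cols M)" using that M by (auto simp: cols_def)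
    from in_span[OF this] obtain b where "lincomb b S = col M j"
      using finite_in_span[OF fin, of "col M j"] Sn by auto
    then show ?thesis by metis
  qed
  then obtain a where a: "\<And>j. j < nc \<Longrightarrow> col M j = lincomb (a j) S" by metis
  let ?L = "mat n (rank M) (\<lambda>(i, k). ss ! k $ i)"
  let ?R = "mat (rank M) nc (\<lambda>(k, j). a j (ss ! k))"
  have "M = ?L * ?R"
  proof (rule eq_matI)
    fix i j assume "i < dim_row (?L * ?R)" "j < dim_col (?L * ?R)"
    then have ij: "i < n" "j < nc" by auto
    have "M $$ (i, j) = col M j $ i" using ij M by simp
    also have "\<dots> = (\<Sum>x\<in>S. a j x * x $ i)" by (simp add: a ij lincomb_index[OF _ Sn])
    also have "\<dots> = (\<Sum>k = 0..<rank M. a j (ss ! k) * ss ! k $ i)"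
      using ss len by (intro sum.reindex_bij_betw[symmetric]) (auto intro: bij_betw_nth)
    finally show "M $$ (i, j) = (?L * ?R) $$ (i, j)"
      using ij by (simp add: scalar_prod_def mult.commute)
  qed (use M in auto)
  then show ?thesis by (meson mat_carrier)
qed

text \<open>More than \<open>k\<close> independent columns of \<open>L * R\<close> would come from
  more than \<open>k\<close> columns of \<open>R\<close>. These form a wide matrix, whose kernel
  vector yields a linear dependence.\<close>

lemma rank_mult_le_inner:
  assumes L: "L \<in> carrier_mat n k" and R: "R \<in> carrier_mat k nc"
  shows "rank (L * R) \<le> k"
proof (rule ccontr)
  assume less: "\<not> rank (L * R) \<le> k"
  let ?M = "L * R"
  let ?P = "\<lambda>T. T \<subseteq> set (cols ?M) \<and> lin_indpt T"
  have M: "?M \<in> carrier_mat n nc" using L R by simp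
  obtain S where max: "maximal S ?P"
    using maximal_exists[of ?P "card (set (cols ?M))" "{}"]
    by (meson List.finite_set card_mono empty_iff empty_subsetI finite_lin_indpt2 rev_finite_subset)
  have S: "S \<subseteq> set (cols ?M)" "lin_indpt S" using max by (auto simp: maximal_def)
  have rk: "rank ?M = card S" using rank_card_indpt[OF M max] .
  obtain ss where ss: "set ss = S" "distinct ss" using S finite_distinct_list finite_subset by blast
  define d where "d = length ss"
  have "k < d" using less rk ss distinct_card d_def by fastforce
  have "\<exists>j. j < nc \<and> ss ! t = col ?M j" if "t < d" for t
  proof -
    have "ss ! t \<in> set (cols ?M)" using that ss S d_def by auto
    then show ?thesis using R by (auto simp: cols_def)
  qed
  then obtain f where f: "\<And>t. t < d \<Longrightarrow> f t < nc \<and> ss ! t = col ?M (f t)" by metis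
  let ?F = "mat_of_cols n ss"
  let ?R' = "mat k d (\<lambda>(a, t). R $$ (a, f t))"
  have F: "?F \<in> carrier_mat n d" by (simp add: d_def)
  have ssn: "set ss \<subseteq> carrier_vec n" using ss(1) S(1) cols_dim[of ?M] L by simp
  have colsF: "cols ?F = ss" using ssn by simp
  have fac: "?F = L * ?R'"
  proof (rule eq_matI)
    fix i t assume "i < dim_row (L * ?R')" "t < dim_col (L * ?R')"
    then have it: "i < n" "t < d" using L by auto
    then have "?F $$ (i, t) = ?M $$ (i, f t)"
      using f[OF it(2)] it L R by (simp add: mat_of_cols_index d_def)
    then show "?F $$ (i, t) = (L * ?R') $$ (i, t)"
      using it f[OF it(2)] L R by (simp add: scalar_prod_def)
  qed (use L in \<open>auto simp: d_def\<close>)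
  obtain v where v: "v \<in> carrier_vec d" "v \<noteq> 0\<^sub>v d" "?R' *\<^sub>v v = 0\<^sub>v k"
    using wide_kernel_nonzero[OF _ \<open>k < d\<close>, of ?R'] by auto
  have "?F *\<^sub>v v = L *\<^sub>v (?R' *\<^sub>v v)"
    unfolding fac by (rule assoc_mult_mat_vec[OF L _ v(1)]) simp
  then have "?F *\<^sub>v v = 0\<^sub>v n" using v L by auto
  then have "lin_dep (set (cols ?F))"
    using lin_depI[OF F v(1,2) \<open>?F *\<^sub>v v = 0\<^sub>v n\<close>] ss(2) colsF by simp
  with S(2) ss(1) colsF show False by simp
qed

end

text \<open>Inserted between two factors, \<open>J * J'\<close> enlarges an inner dimension;
  multiplied from outside, \<open>J\<close> and \<open>J'\<close> cut an identity matrix down to a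
  smaller one.\<close>

lemma ex_one_mat_factor:
  assumes "d \<le> k"
  shows "\<exists>J \<in> carrier_mat d k. \<exists>J' \<in> carrier_mat k d. J * J' = (1\<^sub>m d :: 'a :: semiring_1 mat)"
proof -
  let ?J = "mat d k (\<lambda>(i, j). if j = i then 1 else 0 :: 'a)"
  let ?J' = "mat k d (\<lambda>(i, j). if i = j then 1 else 0 :: 'a)"
  have "?J * ?J' = 1\<^sub>m d"
  proof (rule eq_matI)
    fix i j assume "i < dim_row (1\<^sub>m d :: 'a mat)" "j < dim_col (1\<^sub>m d :: 'a mat)"
    then have ij: "i < d" "j < d" by auto
    then have "(?J * ?J') $$ (i, j) = (\<Sum>l = 0..<k. (if l = i then 1 else 0) * (if l = j then 1 else 0))"
      using assms by (simp add: scalar_prod_def)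
    also have "\<dots> = (\<Sum>l = 0..<k. if l = i then (if i = j then 1 else 0) else 0)"
      by (rule sum.cong) auto
    finally have "(?J * ?J') $$ (i, j) = \<dots>" .
    then show "(?J * ?J') $$ (i, j) = 1\<^sub>m d $$ (i, j)" using ij assms by simp
  qed auto
  then show ?thesis by (intro bexI) auto
qed

lemma mrank_mult_le_inner:
  fixes L :: "'a :: field mat"
  assumes "L \<in> carrier_mat nr k" and "R \<in> carrier_mat k nc"
  shows "mrank (L * R) \<le> k"
  using vec_space.rank_mult_le_inner[OF assms] assms by (simp add: mrank_def)

text \<open>Upper bounds on the rank turn into factorizations, so that later arguments manipulate
  factors instead of spans. A rank factorization is padded to inner dimension \<open>k\<close> by
  inserting \<open>J * J'\<close>.\<close>

lemma mrank_le_iff_factor: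
  assumes M: "M \<in> carrier_mat nr nc"
  shows "mrank M \<le> k \<longleftrightarrow> (\<exists>L \<in> carrier_mat nr k. \<exists>R \<in> carrier_mat k nc. M = L * R)"
proof
  assume le: "mrank M \<le> k"
  have rk: "mrank M = vec_space.rank nr M" using M by (simp add: mrank_def)
  define d where "d = mrank M"
  obtain L R where L: "L \<in> carrier_mat nr d" and R: "R \<in> carrier_mat d nc" and MLR: "M = L * R"
    using vec_space.rank_factorization[OF M] unfolding d_def rk by blast
  obtain J J' where J: "J \<in> carrier_mat d k" "J' \<in> carrier_mat k d" "J * J' = (1\<^sub>m d :: 'a mat)"
    using ex_one_mat_factor[of d k] le unfolding d_def by blast
  have "M = L * ((J * J') * R)" using R MLR J by simp
  also have "\<dots> = L * (J * (J' * R))" using J R by (subst assoc_mult_mat[of J d k J' d R nc]) auto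
  also have "\<dots> = (L * J) * (J' * R)" using J L R by (subst assoc_mult_mat[of L nr d J k "J' * R" nc]) auto
  finally show "\<exists>L \<in> carrier_mat nr k. \<exists>R \<in> carrier_mat k nc. M = L * R"
    using L R J by (intro bexI[of _ "L * J"] bexI[of _ "J' * R"]) auto
next
  assume "\<exists>L \<in> carrier_mat nr k. \<exists>R \<in> carrier_mat k nc. M = L * R"
  then obtain L R where "L \<in> carrier_mat nr k" "R \<in> carrier_mat k nc" "M = L * R" by blast
  with mrank_mult_le_inner[of L nr k R nc] show "mrank M \<le> k" by simp
qed

text \<open>Versions of the ring laws whose side conditions the simplifier can discharge by
  computing dimensions; the carrier-based ones have unbound dimensions in their premises.\<close>

named_theorems mat_dim

lemma mult_assoc_dim [mat_dim]:
  fixes A :: "'a :: semiring_0 mat"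
  assumes "dim_col A = dim_row B" "dim_col B = dim_row C"
  shows "A * B * C = A * (B * C)"
  using assms by (intro assoc_mult_mat) auto

lemma add_mult_dim [mat_dim]:
  fixes A :: "'a :: semiring_0 mat"
  assumes "dim_row A = dim_row B" "dim_col A = dim_col B" "dim_col B = dim_row C"
  shows "(A + B) * C = A * C + B * C"
  using assms by (intro add_mult_distrib_mat) auto

lemma mult_add_dim [mat_dim]:
  fixes A :: "'a :: semiring_0 mat"
  assumes "dim_row B = dim_row C" "dim_col B = dim_col C" "dim_col A = dim_row C"
  shows "A * (B + C) = A * B + A * C"
  using assms by (intro mult_add_distrib_mat) auto

lemma minus_mult_dim [mat_dim]:
  fixes A :: "'a :: ring mat"
  assumes "dim_row A = dim_row B" "dim_col A = dim_col B" "dim_col B = dim_row C"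
  shows "(A - B) * C = A * C - B * C"
  using assms by (intro minus_mult_distrib_mat) auto

lemma mult_minus_dim [mat_dim]:
  fixes A :: "'a :: ring mat"
  assumes "dim_row B = dim_row C" "dim_col B = dim_col C" "dim_col A = dim_row C"
  shows "A * (B - C) = A * B - A * C"
  using assms by (intro mult_minus_distrib_mat) auto

lemma minus_self_dim [mat_dim]: "A - A = 0\<^sub>m (dim_row A) (dim_col A)"
  for A :: "'a :: ring mat"
  by (rule eq_matI) auto

lemma minus_zero_dim [mat_dim]: "dim_row A = nr \<Longrightarrow> dim_col A = nc \<Longrightarrow> A - 0\<^sub>m nr nc = A"
  for A :: "'a :: ring mat"
  by (rule eq_matI) auto

section \<open>Rank as the largest size of an identity \<open>X * M * Y\<close>\<close>

lemma mrank_mult_le: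
  fixes P :: "'a :: field mat"
  assumes X: "X \<in> carrier_mat n nr" and P: "P \<in> carrier_mat nr nc" and Y: "Y \<in> carrier_mat nc k"
  shows "mrank (X * P * Y) \<le> mrank P"
proof -
  define d where "d = mrank P"
  obtain L R where L: "L \<in> carrier_mat nr d" and R: "R \<in> carrier_mat d nc" and LR: "P = L * R"
    using mrank_le_iff_factor[OF P, of d] d_def by blast
  have "dim_row L = nr" "dim_col L = d" "dim_row R = d" "dim_col R = nc" "dim_col X = nr" "dim_row Y = nc"
    using L R X Y by auto
  then have "X * P * Y = (X * L) * (R * Y)"
    unfolding LR by (simp add: mat_dim)
  moreover have "X * L \<in> carrier_mat n d" "R * Y \<in> carrier_mat d k"
    using X L R Y by auto
  moreover have "X * P * Y \<in> carrier_mat n k" using X P Y by auto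
  ultimately show ?thesis
    using mrank_le_iff_factor[of "X * P * Y" n k d] d_def by blast
qed

lemma mrank_one_mat [simp]: "mrank (1\<^sub>m d :: 'a :: field mat) = d"
  using vec_space.det_rank_iff[of "1\<^sub>m d :: 'a mat" d] by (simp add: mrank_def)

lemma mrank_eq_dim_iff_det:
  fixes M :: "'a :: field mat"
  assumes "M \<in> carrier_mat n n"
  shows "n \<le> mrank M \<longleftrightarrow> det M \<noteq> 0"
  using vec_space.det_rank_iff[OF assms] vec_space.rank_le_nc[OF assms] assms
  by (auto simp: mrank_def)

text \<open>If \<open>X M Y = 1\<close> but \<open>M \<noteq> M Y X M\<close>, then a nonzero entry of \<open>M - M Y X M\<close> allows
  to extend \<open>X\<close> by a row and \<open>Y\<close> by a column (Wedderburn's rank reduction).\<close>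

lemma wedderburn_step:
  fixes M :: "'a :: field mat"
  assumes M: "M \<in> carrier_mat nr nc" and X: "X \<in> carrier_mat k nr" and Y: "Y \<in> carrier_mat nc k"
    and XMY: "X * M * Y = 1\<^sub>m k" and neq: "M \<noteq> M * Y * (X * M)"
  shows "\<exists>X' \<in> carrier_mat (Suc k) nr. \<exists>Y' \<in> carrier_mat nc (Suc k). X' * M * Y' = 1\<^sub>m (Suc k)"
proof -
  define D where "D = M - M * Y * (X * M)"
  have D: "D \<in> carrier_mat nr nc" using M X Y by (auto simp: D_def)
  obtain i j where ij: "i < nr" "j < nc" and "M $$ (i, j) \<noteq> (M * Y * (X * M)) $$ (i, j)"
    using neq M X Y by (metis carrier_matD eq_matI index_mult_mat(2,3))
  then have a0: "D $$ (i, j) \<noteq> 0" using M X Y by (simp add: D_def)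
  define a where "a = D $$ (i, j)"
  \<comment> \<open>\<open>U\<close> and \<open>W\<close> are projections with
    \<open>U * M * Y = 0\<close> and \<open>X * M * W = 0\<close>. A row of \<open>U\<close> and a
    column of \<open>W\<close> therefore pair to zero, through \<open>M\<close>, with the old
    columns of \<open>Y\<close> and rows of \<open>X\<close>.\<close>
  define U where "U = 1\<^sub>m nr - M * Y * X"
  define W where "W = 1\<^sub>m nc - Y * (X * M)"
  have U: "U \<in> carrier_mat nr nr" and W: "W \<in> carrier_mat nc nc"
    using M X Y by (auto simp: U_def W_def)
  have MYk: "M * Y \<in> carrier_mat nr k" "X * M \<in> carrier_mat k nc" using M X Y by auto
  have dims: "dim_row M = nr" "dim_col M = nc" "dim_row X = k" "dim_col X = nr"
    "dim_row Y = nc" "dim_col Y = k"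
    using M X Y by auto
  have XMY': "X * (M * Y) = 1\<^sub>m k" and XMYZ: "X * (M * (Y * Z)) = Z" if "dim_row Z = k" for Z
  proof -
    show "X * (M * Y) = 1\<^sub>m k" using XMY dims by (simp add: mat_dim)
    have "X * (M * (Y * Z)) = X * M * Y * Z" using dims that by (simp add: mat_dim)
    then show "X * (M * (Y * Z)) = Z"
      unfolding XMY using left_mult_one_mat[OF carrier_matI, OF that refl] by simp
  qed
  have UM: "U * M = D"
    unfolding U_def D_def using dims by (simp add: mat_dim)
  have UMY: "U * M * Y = 0\<^sub>m nr k"
    unfolding U_def using dims XMY' by (simp add: mat_dim)
  have XMW: "X * M * W = 0\<^sub>m k nc"
    unfolding W_def using dims XMYZ by (simp add: mat_dim)
  have UMW: "U * M * W = D"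
    unfolding U_def W_def D_def using dims XMYZ by (simp add: mat_dim)
  \<comment> \<open>The new diagonal entry comes from entry \<open>(i, j)\<close> of
    \<open>U * M * W = D\<close>, which is \<open>a\<close>; the factor \<open>inverse a\<close>
    normalizes it to 1.\<close>
  define X' where "X' = mat\<^sub>r (Suc k) nr (\<lambda>t. if t < k then row X t else row U i)"
  define Y' where "Y' = mat nc (Suc k) (\<lambda>(s, t). if t < k then Y $$ (s, t) else inverse a * W $$ (s, j))"
  have X': "X' \<in> carrier_mat (Suc k) nr" and Y': "Y' \<in> carrier_mat nc (Suc k)"
    by (auto simp: X'_def Y'_def)
  have rowX': "row X' t = (if t < k then row X t else row U i)" if "t < Suc k" for t
    using that X U ij by (simp add: X'_def)
  have colY': "col Y' t = (if t < k then col Y t else inverse a \<cdot>\<^sub>v col W j)" if "t < Suc k" for t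
    using that Y W ij by (intro eq_vecI) (auto simp: Y'_def)
  have ent: "(P * M * Q) $$ (s, t) = row P s \<bullet> (M *\<^sub>v col Q t)"
    if "P \<in> carrier_mat p nr" "Q \<in> carrier_mat nc p'" "s < p" "t < p'" for P Q p p' s t
    using that M assoc_mult_mat[of P p nr M nc Q p'] by (simp add: mult_mat_vec_def)
  have "X' * M * Y' = 1\<^sub>m (Suc k)"
  proof (rule eq_matI)
    fix s t assume "s < dim_row (1\<^sub>m (Suc k) :: 'a mat)" "t < dim_col (1\<^sub>m (Suc k) :: 'a mat)"
    then have st: "s < Suc k" "t < Suc k" by auto
    have Mv: "M *\<^sub>v (z \<cdot>\<^sub>v col W j) = z \<cdot>\<^sub>v (M *\<^sub>v col W j)" for z
      using M W ij by (simp add: mult_mat_vec[of M nr nc])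
    have Xs: "row X s \<in> carrier_vec nr" "row U i \<in> carrier_vec nr" "M *\<^sub>v col W j \<in> carrier_vec nr"
      using row_carrier[of X s] row_carrier[of U i] dims(1,4) U carrier_vecI[of "M *\<^sub>v col W j" nr]
      by simp_all
    have eq: "(X' * M * Y') $$ (s, t) = row X' s \<bullet> (M *\<^sub>v col Y' t)"
      using ent[OF X' Y' st] .
    consider "s < k" "t < k" | "s < k" "t = k" | "s = k" "t < k" | "s = k" "t = k"
      using st by linarith
    then show "(X' * M * Y') $$ (s, t) = 1\<^sub>m (Suc k) $$ (s, t)"
    proof cases
      case 1
      then show ?thesis using ent[OF X Y, of s t] XMY unfolding eq by (simp add: rowX' colY')
    next
      case 2
      then show ?thesis using ent[OF X W, of s j] XMW ij Xs unfolding eq by (simp add: rowX' colY' Mv)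
    next
      case 3
      then show ?thesis using ent[OF U Y, of i t] UMY ij unfolding eq by (simp add: rowX' colY')
    next
      case 4
      then show ?thesis using ent[OF U W, of i j] UMW ij Xs a0 unfolding eq
        by (simp add: rowX' colY' Mv a_def)
    qed
  qed (use X' Y' in auto)
  with X' Y' show ?thesis by blast
qed

text \<open>The counterpart of factorizations for lower bounds on the rank. The greatest attainable
  size \<open>d\<close> exists because attainable sizes are bounded by the rank; it is shown to
  reach the rank, and smaller identities are cut out by \<open>J\<close> and
  \<open>J'\<close>.\<close>

lemma le_mrank_iff_one:
  fixes M :: "'a :: field mat"
  assumes M: "M \<in> carrier_mat nr nc"
  shows "k \<le> mrank M \<longleftrightarrow> (\<exists>X \<in> carrier_mat k nr. \<exists>Y \<in> carrier_mat nc k. X * M * Y = 1\<^sub>m k)"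
proof
  let ?E = "\<lambda>k. \<exists>X \<in> carrier_mat k nr. \<exists>Y \<in> carrier_mat nc k. X * M * Y = (1\<^sub>m k :: 'a mat)"
  have bound: "k \<le> mrank M" if "?E k" for k
    using that mrank_mult_le[OF _ M] mrank_one_mat[of k, where ?'a = 'a] by metis
  show "k \<le> mrank M" if "?E k" using bound that .
  assume k: "k \<le> mrank M"
  have "?E 0" by (intro bexI[of _ "0\<^sub>m 0 nr"] bexI[of _ "0\<^sub>m nc 0"]) auto
  then have d: "?E (Greatest ?E)"
    by (rule GreatestI_nat) (rule bound)
  have max: "e \<le> Greatest ?E" if "?E e" for e
    using that by (rule Greatest_le_nat) (rule bound)
  define d where "d = Greatest ?E"
  note d = d[folded d_def] and max = max[folded d_def]
  obtain X Y where X: "X \<in> carrier_mat d nr" and Y: "Y \<in> carrier_mat nc d" and XMY: "X * M * Y = 1\<^sub>m d"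
    using d by blast
  \<comment> \<open>By maximality of \<open>d\<close> no Wedderburn step is possible; the resulting
    equation factors \<open>M\<close> through dimension \<open>d\<close>.\<close>
  have "M = M * Y * (X * M)"
    using wedderburn_step[OF M X Y XMY] max[of "Suc d"] by fastforce
  then have "mrank M \<le> d"
    using mrank_le_iff_factor[OF M, of d] mult_carrier_mat[OF M Y] mult_carrier_mat[OF X M] by blast
  then obtain J J' where J: "J \<in> carrier_mat k d" "J' \<in> carrier_mat d k" "J * J' = (1\<^sub>m k :: 'a mat)"
    using ex_one_mat_factor[of k d] k by auto
  have "dim_col J = d" "dim_row J' = d" "dim_row X = d" "dim_col X = nr" "dim_row M = nr" "dim_col M = nc"
    "dim_row Y = nc" "dim_col Y = d"
    using J X M Y by auto
  then have "(J * X) * M * (Y * J') = J * (X * M * Y) * J'"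
    by (simp add: mat_dim)
  then have "(J * X) * M * (Y * J') = 1\<^sub>m k" using XMY J by simp
  then show "?E k" using J X Y by (intro bexI[of _ "J * X"] bexI[of _ "Y * J'"]) auto
qed

subsection \<open>Rank-one updates\<close>

lemma mrank_sandwich_ge:
  fixes P :: "'a :: field mat"
  assumes X: "X \<in> carrier_mat m nr" and P: "P \<in> carrier_mat nr nc" and Y: "Y \<in> carrier_mat nc m"
    and "det (X * P * Y) \<noteq> 0"
  shows "m \<le> mrank P"
proof -
  have "m \<le> mrank (X * P * Y)"
    using assms mrank_eq_dim_iff_det[of "X * P * Y" m] by simp
  with mrank_mult_le[OF X P Y] show ?thesis by simp
qed

text \<open>For \<open>t \<noteq> 0\<close> the matrix is \<open>t\<close> times \<open>N\<close>
  shifted by \<open>inverse t\<close>, which is singular only if \<open>- inverse t\<close> is one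
  of the finitely many eigenvalues of \<open>N\<close>.\<close>

lemma finite_det_one_plus_smult_zero:
  fixes N :: "'a :: field mat"
  assumes N: "N \<in> carrier_mat m m"
  shows "finite {t. det (1\<^sub>m m + t \<cdot>\<^sub>m N) = 0}"
proof (rule finite_subset)
  show "finite (insert 0 ((\<lambda>e. - inverse e) ` spectrum N))"
    using card_finite_spectrum(1)[OF N] by simp
  show "{t. det (1\<^sub>m m + t \<cdot>\<^sub>m N) = 0} \<subseteq> insert 0 ((\<lambda>e. - inverse e) ` spectrum N)"
  proof
    fix t assume "t \<in> {t. det (1\<^sub>m m + t \<cdot>\<^sub>m N) = 0}"
    then have det0: "det (1\<^sub>m m + t \<cdot>\<^sub>m N) = 0" by simp
    show "t \<in> insert 0 ((\<lambda>e. - inverse e) ` spectrum N)"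
    proof (cases "t = 0")
      case False
      have "1\<^sub>m m + t \<cdot>\<^sub>m N = t \<cdot>\<^sub>m char_matrix N (- inverse t)"
        using N False by (intro eq_matI) (auto simp: char_matrix_def field_simps)
      then have "det (char_matrix N (- inverse t)) = 0"
        using det0 False N by (simp add: char_matrix_def)
      then have "- inverse t \<in> spectrum N"
        using eigenvalue_det[OF N] by (simp add: spectrum_def)
      moreover have "t = - inverse (- inverse t)" by simp
      ultimately show ?thesis by (metis image_eqI insertI2)
    qed simp
  qed
qed

text \<open>A rank below \<open>m\<close> leaves a spare coordinate in an inner dimension of
  \<open>m\<close>. The unit vectors \<open>u\<close> and \<open>w\<close> of that coordinate allow
  a rank-one term to be absorbed into the factors.\<close>

lemma mrank_less_padded_factor:
  fixes P :: "'a :: field mat"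
  assumes P: "P \<in> carrier_mat nr nc" and less: "mrank P < m"
  shows "\<exists>L \<in> carrier_mat nr m. \<exists>R \<in> carrier_mat m nc. \<exists>u \<in> carrier_mat m 1. \<exists>w \<in> carrier_mat 1 m.
    P = L * R \<and> L * u = 0\<^sub>m nr 1 \<and> w * R = 0\<^sub>m 1 nc \<and> w * u = 1\<^sub>m 1"
proof -
  obtain n where m: "m = Suc n" using less by (cases m) auto
  obtain L R where L: "L \<in> carrier_mat nr n" and R: "R \<in> carrier_mat n nc" and LR: "P = L * R"
    using mrank_le_iff_factor[OF P, of n] less m by auto
  \<comment> \<open>The spare coordinate is the last one, with index \<open>n\<close>: there
    \<open>?L\<close> has a zero column and \<open>?R\<close> a zero row.\<close>
  let ?L = "mat nr m (\<lambda>(i, j). if j < n then L $$ (i, j) else 0)"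
  let ?R = "mat m nc (\<lambda>(i, j). if i < n then R $$ (i, j) else 0)"
  let ?u = "mat m 1 (\<lambda>(i, j). if i = n then 1 else 0 :: 'a)"
  let ?w = "mat 1 m (\<lambda>(i, j). if j = n then 1 else 0 :: 'a)"
  have "P = ?L * ?R" "?L * ?u = 0\<^sub>m nr 1" "?w * ?R = 0\<^sub>m 1 nc" "?w * ?u = 1\<^sub>m 1"
    unfolding LR using L R by (auto intro!: eq_matI simp: m scalar_prod_def)
  then show ?thesis
    by (intro bexI[of _ ?L] bexI[of _ ?R] bexI[of _ ?u] bexI[of _ ?w] conjI mat_carrier)
qed

text \<open>Each \<open>P + s * t\<close> factors through dimension \<open>m\<close> with
  \<open>s\<close> only in the left and \<open>t\<close> only in the right factor. Determinants of
  \<open>m \<times> m\<close> sandwiches therefore split, and the good left factor of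
  \<open>b\<close> combines with the good right factor of \<open>c\<close>.\<close>

lemma rank_one_update_exceeds:
  fixes P :: "'a :: field mat"
  assumes P: "P \<in> carrier_mat nr nc" and b: "b \<in> carrier_mat nr 1" and y: "y \<in> carrier_mat nr 1"
    and x: "x \<in> carrier_mat 1 nc" and c: "c \<in> carrier_mat 1 nc"
    and less: "mrank P < m" and bx: "m \<le> mrank (P + b * x)" and yc: "m \<le> mrank (P + y * c)"
  shows "m \<le> mrank (P + b * c)"
proof -
  obtain L R u w where L: "L \<in> carrier_mat nr m" and R: "R \<in> carrier_mat m nc"
    and u: "u \<in> carrier_mat m 1" and w: "w \<in> carrier_mat 1 m"
    and LR: "P = L * R" and Lu: "L * u = 0\<^sub>m nr 1" and wR: "w * R = 0\<^sub>m 1 nc" and wu: "w * u = 1\<^sub>m 1"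
    using mrank_less_padded_factor[OF P less] by blast
  \<comment> \<open>The cross terms vanish by \<open>L * u = 0\<close> and \<open>w * R = 0\<close>,
    and \<open>w * u = 1\<close> leaves \<open>s * t\<close>.\<close>
  have fac: "P + s * t = (L + s * w) * (R + u * t)"
    if s: "s \<in> carrier_mat nr 1" and t: "t \<in> carrier_mat 1 nc" for s t
  proof -
    have dims: "dim_row L = nr" "dim_col L = m" "dim_row R = m" "dim_col R = nc" "dim_row u = m"
      "dim_col u = 1" "dim_row w = 1" "dim_col w = m" "dim_row s = nr" "dim_col s = 1"
      "dim_row t = 1" "dim_col t = nc"
      using L R u w s t by auto
    have "L * (u * t) = (L * u) * t" "w * (u * t) = (w * u) * t"
      using dims by (simp_all add: mat_dim)
    then have "L * (u * t) = 0\<^sub>m nr nc" "w * (u * t) = t"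
      using Lu wu t by simp_all
    then have "(L + s * w) * (R + u * t) = L * R + s * t"
      using dims wR s L R t by (simp add: mat_dim)
    then show ?thesis using LR by simp
  qed
  have Lw: "L + s * w \<in> carrier_mat nr m" and Ru: "R + u * t \<in> carrier_mat m nc"
    if "s \<in> carrier_mat nr 1" "t \<in> carrier_mat 1 nc" for s t
    using that L R u w by auto
  have carr: "P + s * t \<in> carrier_mat nr nc"
    if "s \<in> carrier_mat nr 1" "t \<in> carrier_mat 1 nc" for s t
    using that P by auto
  obtain X Y where X: "X \<in> carrier_mat m nr" and Y: "Y \<in> carrier_mat nc m"
    and XY: "X * (P + b * x) * Y = 1\<^sub>m m"
    using le_mrank_iff_one[OF carr[OF b x]] bx by blast
  obtain X' Y' where X': "X' \<in> carrier_mat m nr" and Y': "Y' \<in> carrier_mat nc m"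
    and XY': "X' * (P + y * c) * Y' = 1\<^sub>m m"
    using le_mrank_iff_one[OF carr[OF y c]] yc by blast
  have det_split: "det (X * (P + s * t) * Y) = det (X * (L + s * w)) * det ((R + u * t) * Y)"
    if "s \<in> carrier_mat nr 1" "t \<in> carrier_mat 1 nc" "X \<in> carrier_mat m nr" "Y \<in> carrier_mat nc m"
    for s t X Y
  proof -
    note F = Lw[OF that(1,2)] and G = Ru[OF that(1,2)]
    have "X * (P + s * t) * Y = X * (L + s * w) * ((R + u * t) * Y)"
      unfolding fac[OF that(1,2)]
      by (simp only: assoc_mult_mat[OF that(3) mult_carrier_mat[OF F G] that(4)] assoc_mult_mat[OF F G that(4)]
          assoc_mult_mat[OF that(3) F mult_carrier_mat[OF G that(4)]])
    then show ?thesis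
      using det_mult[OF mult_carrier_mat[OF that(3) F] mult_carrier_mat[OF G that(4)]] by simp
  qed
  have "det (X * (L + b * w)) \<noteq> 0"
    using det_split[OF b x X Y] XY by auto
  moreover have "det ((R + u * c) * Y') \<noteq> 0"
    using det_split[OF y c X' Y'] XY' by auto
  \<comment> \<open>\<open>X\<close> from the first identity may be mixed with \<open>Y'\<close>
    from the second, since each determinant involves only its own side.\<close>
  ultimately have "det (X * (P + b * c) * Y') \<noteq> 0"
    unfolding det_split[OF b c X Y'] by simp
  then show ?thesis
    using mrank_sandwich_ge[OF X carr[OF b c] Y'] by blast
qed

text \<open>If \<open>P\<close> itself has rank at least \<open>m\<close>, a sandwich of the update
  is \<open>1 + t N\<close>, singular for finitely many \<open>t\<close> only. Otherwise the
  preceding lemma makes every nonzero \<open>t\<close> good.\<close>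

lemma finite_bad_rank_one_update:
  fixes P :: "'a :: field mat"
  assumes P: "P \<in> carrier_mat nr nc" and b: "b \<in> carrier_mat nr 1" and y: "y \<in> carrier_mat nr 1"
    and x: "x \<in> carrier_mat 1 nc" and c: "c \<in> carrier_mat 1 nc"
    and bx: "m \<le> mrank (P + b * x)" and yc: "m \<le> mrank (P + y * c)"
  shows "finite {t. mrank (P + t \<cdot>\<^sub>m (b * c)) < m}"
proof (cases "m \<le> mrank P")
  case True
  then obtain X Y where X: "X \<in> carrier_mat m nr" and Y: "Y \<in> carrier_mat nc m"
    and XY: "X * P * Y = 1\<^sub>m m"
    using le_mrank_iff_one[OF P, of m] by auto
  let ?N = "X * (b * c) * Y"
  have "{t. mrank (P + t \<cdot>\<^sub>m (b * c)) < m} \<subseteq> {t. det (1\<^sub>m m + t \<cdot>\<^sub>m ?N) = 0}"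
  proof
    fix t assume "t \<in> {t. mrank (P + t \<cdot>\<^sub>m (b * c)) < m}"
    moreover have "X * (P + t \<cdot>\<^sub>m (b * c)) * Y = 1\<^sub>m m + t \<cdot>\<^sub>m ?N"
    proof -
      have bc: "b * c \<in> carrier_mat nr nc" using b c by simp
      have "X * (P + t \<cdot>\<^sub>m (b * c)) = X * P + t \<cdot>\<^sub>m (X * (b * c))"
        using mult_add_distrib_mat[OF X P, of "t \<cdot>\<^sub>m (b * c)"] mult_smult_distrib[OF X bc] bc by simp
      moreover have "(X * P + t \<cdot>\<^sub>m (X * (b * c))) * Y = X * P * Y + t \<cdot>\<^sub>m (X * (b * c)) * Y"
        using X P Y bc by (intro add_mult_distrib_mat[of _ m nc]) auto
      moreover have "t \<cdot>\<^sub>m (X * (b * c)) * Y = t \<cdot>\<^sub>m ?N"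
        using X Y bc by (intro mult_smult_assoc_mat[of _ m nc]) auto
      ultimately show ?thesis using XY by simp
    qed
    ultimately show "t \<in> {t. det (1\<^sub>m m + t \<cdot>\<^sub>m ?N) = 0}"
      using mrank_sandwich_ge[OF X _ Y, of "P + t \<cdot>\<^sub>m (b * c)"] P b c by fastforce
  qed
  then show ?thesis
    using finite_det_one_plus_smult_zero[of ?N m] X Y b c finite_subset by (meson mult_carrier_mat)
next
  case False
  have "m \<le> mrank (P + t \<cdot>\<^sub>m (b * c))" if "t \<noteq> 0" for t
  proof -
    \<comment> \<open>Scaling \<open>c\<close> by \<open>t\<close> and \<open>y\<close> by
      \<open>inverse t\<close> preserves the hypothesis on \<open>y * c\<close> and turns
      \<open>b * c\<close> into the update in question.\<close>
    have "(inverse t \<cdot>\<^sub>m y) * (t \<cdot>\<^sub>m c) = y * c" "b * (t \<cdot>\<^sub>m c) = t \<cdot>\<^sub>m (b * c)"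
      using that y c b by (auto intro!: eq_matI simp: scalar_prod_def)
    then show ?thesis
      using rank_one_update_exceeds[OF P b _ x _ _ bx, of "inverse t \<cdot>\<^sub>m y" "t \<cdot>\<^sub>m c"] False yc y c
      by simp
  qed
  then have "{t. mrank (P + t \<cdot>\<^sub>m (b * c)) < m} \<subseteq> {0}" by force
  then show ?thesis using finite_subset by blast
qed

text \<open>A scalar gain \<open>k e\<close> on the rank-one term of \<open>e\<close> can be fixed to a value that is good for
  all of the finitely many choices for the remaining terms.\<close>

theorem rank_one_terms_gain:
  fixes Q :: "'a :: field mat" and b y c x :: "'e \<Rightarrow> nat \<Rightarrow> 'a"
  assumes inf: "infinite (UNIV :: 'a set)" and fin: "finite E" and Q: "Q \<in> carrier_mat nr nc"
    and ranks: "\<And>S. S \<subseteq> E \<Longrightarrow>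
      m \<le> mrank (mat nr nc (\<lambda>(i, j). Q $$ (i, j) + (\<Sum>e\<in>S. b e i * x e j) + (\<Sum>e\<in>E - S. y e i * c e j)))"
  shows "\<exists>k. m \<le> mrank (mat nr nc (\<lambda>(i, j). Q $$ (i, j) + (\<Sum>e\<in>E. k e * b e i * c e j)))"
  using fin Q ranks
proof (induction E arbitrary: Q)
  case empty
  then show ?case using empty(2)[of "{}"] by simp
next
  case (insert e E)
  let ?col = "\<lambda>v. mat nr 1 (\<lambda>(i, _). v i) :: 'a mat" and ?row = "\<lambda>v. mat 1 nc (\<lambda>(_, j). v j) :: 'a mat"
  let ?P = "\<lambda>S. mat nr nc (\<lambda>(i, j). Q $$ (i, j) + (\<Sum>e\<in>S. b e i * x e j) + (\<Sum>e\<in>E - S. y e i * c e j))"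
  have fins: "finite S" if "S \<subseteq> E" for S using that insert.hyps(1) finite_subset by blast
  \<comment> \<open>For fixed \<open>S\<close> the two rank hypotheses are those of
    \<open>insert e S\<close>, where \<open>e\<close> contributes \<open>b e\<close> times
    \<open>x e\<close>, and of \<open>S\<close> itself, where it contributes \<open>y e\<close>
    times \<open>c e\<close>.\<close>
  have "finite {t. mrank (?P S + t \<cdot>\<^sub>m (?col (b e) * ?row (c e))) < m}" if S: "S \<subseteq> E" for S
  proof (rule finite_bad_rank_one_update)
    have eS: "e \<notin> S" "e \<notin> E - S" using S insert.hyps(2) by auto
    have "insert e E - insert e S = E - S" using insert.hyps(2) by auto
    then have "?P S + ?col (b e) * ?row (x e) =
        mat nr nc (\<lambda>(i, j). Q $$ (i, j) + (\<Sum>e\<in>insert e S. b e i * x e j)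
          + (\<Sum>e\<in>insert e E - insert e S. y e i * c e j))"
      using eS fins[OF S] by (intro eq_matI) (auto simp: scalar_prod_def)
    then show "m \<le> mrank (?P S + ?col (b e) * ?row (x e))"
      using insert.prems(2)[of "insert e S"] S by auto
    have "insert e E - S = insert e (E - S)" using eS by auto
    then have "?P S + ?col (y e) * ?row (c e) =
        mat nr nc (\<lambda>(i, j). Q $$ (i, j) + (\<Sum>e\<in>S. b e i * x e j)
          + (\<Sum>e\<in>insert e E - S. y e i * c e j))"
      using eS insert.hyps(1) by (intro eq_matI) (auto simp: scalar_prod_def)
    then show "m \<le> mrank (?P S + ?col (y e) * ?row (c e))"
      using insert.prems(2)[of S] S by auto
  qed auto
  then have "finite (\<Union>S \<in> Pow E. {t. mrank (?P S + t \<cdot>\<^sub>m (?col (b e) * ?row (c e))) < m})"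
    using insert.hyps(1) by blast
  then obtain t where tU: "t \<notin> (\<Union>S \<in> Pow E. {t. mrank (?P S + t \<cdot>\<^sub>m (?col (b e) * ?row (c e))) < m})"
    using ex_new_if_finite[OF inf] by blast
  have t: "m \<le> mrank (?P S + t \<cdot>\<^sub>m (?col (b e) * ?row (c e)))" if "S \<subseteq> E" for S
    using tU that by (simp add: linorder_not_less)
  \<comment> \<open>The chosen term is moved into the constant part, so that the induction
    hypothesis for \<open>E\<close> applies to \<open>Q'\<close>.\<close>
  define Q' where "Q' = mat nr nc (\<lambda>(i, j). Q $$ (i, j) + t * b e i * c e j)"
  have "m \<le> mrank (mat nr nc (\<lambda>(i, j). Q' $$ (i, j) + (\<Sum>e\<in>S. b e i * x e j) + (\<Sum>e\<in>E - S. y e i * c e j)))"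
    if "S \<subseteq> E" for S
  proof -
    have "?P S + t \<cdot>\<^sub>m (?col (b e) * ?row (c e)) =
        mat nr nc (\<lambda>(i, j). Q' $$ (i, j) + (\<Sum>e\<in>S. b e i * x e j) + (\<Sum>e\<in>E - S. y e i * c e j))"
      by (rule eq_matI) (auto simp: scalar_prod_def Q'_def)
    with t[OF that] show ?thesis by simp
  qed
  moreover have "Q' \<in> carrier_mat nr nc" by (simp add: Q'_def)
  ultimately obtain k where k: "m \<le> mrank (mat nr nc (\<lambda>(i, j). Q' $$ (i, j) + (\<Sum>e\<in>E. k e * b e i * c e j)))"
    using insert.IH by blast
  have eq: "mat nr nc (\<lambda>(i, j). Q $$ (i, j) + (\<Sum>e'\<in>insert e E. (k(e := t)) e' * b e' i * c e' j)) =
      mat nr nc (\<lambda>(i, j). Q' $$ (i, j) + (\<Sum>e\<in>E. k e * b e i * c e j))"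
  proof (rule eq_matI, goal_cases)
    case (1 i j)
    have "(\<Sum>e'\<in>E. (k(e := t)) e' * b e' i * c e' j) = (\<Sum>e'\<in>E. k e' * b e' i * c e' j)"
      using insert.hyps(2) by (intro sum.cong) auto
    then show ?case using 1 insert.hyps by (simp add: Q'_def)
  qed auto
  show ?case
    by (rule exI[of _ "k(e := t)"]) (subst eq, rule k)
qed

subsection \<open>Block matrices\<close>

text \<open>Reindexing the rows of \<open>L\<close> and the columns of \<open>R\<close> keeps the
  inner dimension, even if rows or columns are dropped or repeated.\<close>

lemma mrank_reindex_le:
  fixes W :: "'a :: field mat"
  assumes W: "W \<in> carrier_mat nr nc" and f: "\<And>i. i < nr' \<Longrightarrow> f i < nr" and g: "\<And>j. j < nc' \<Longrightarrow> g j < nc"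
  shows "mrank (mat nr' nc' (\<lambda>(i, j). W $$ (f i, g j))) \<le> mrank W"
proof -
  define d where "d = mrank W"
  obtain L R where L: "L \<in> carrier_mat nr d" and R: "R \<in> carrier_mat d nc" and LR: "W = L * R"
    using mrank_le_iff_factor[OF W, of d] d_def by blast
  let ?L = "mat nr' d (\<lambda>(i, k). L $$ (f i, k))" and ?R = "mat d nc' (\<lambda>(k, j). R $$ (k, g j))"
  have "mat nr' nc' (\<lambda>(i, j). W $$ (f i, g j)) = ?L * ?R"
    unfolding LR using L R f g by (intro eq_matI) (auto simp: scalar_prod_def)
  then show ?thesis
    using mrank_mult_le_inner[of ?L nr' d ?R nc'] d_def by simp
qed

text \<open>Extending the factors of \<open>M\<close> by zeros factors \<open>W\<close>. This
  removes the border once all gains are fixed.\<close>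

lemma mrank_zero_border:
  fixes M :: "'a :: field mat"
  assumes M: "M \<in> carrier_mat m m"
    and W: "W = mat (m + N) (m + N) (\<lambda>(i, j). if i < m \<and> j < m then M $$ (i, j) else 0)"
  shows "mrank W \<le> mrank M"
proof -
  define d where "d = mrank M"
  obtain L R where L: "L \<in> carrier_mat m d" and R: "R \<in> carrier_mat d m" and LR: "M = L * R"
    using mrank_le_iff_factor[OF M, of d] d_def by blast
  let ?L = "mat (m + N) d (\<lambda>(i, k). if i < m then L $$ (i, k) else 0)"
  let ?R = "mat d (m + N) (\<lambda>(k, j). if j < m then R $$ (k, j) else 0)"
  have "W = ?L * ?R"
    unfolding W LR using L R by (intro eq_matI) (auto simp: scalar_prod_def)
  then show ?thesis
    using mrank_mult_le_inner[of ?L "m + N" d ?R "m + N"] d_def by simp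
qed

section \<open>Horizontal and vertical concatenation\<close>

lemma index_append_cols:
  assumes "i < nr" "j < dim_col M + dim_col N" "dim_row M = nr" "dim_row N = nr"
  shows "append_cols M N $$ (i, j) = (if j < dim_col M then M $$ (i, j) else N $$ (i, j - dim_col M))"
  using assms by (auto simp: append_cols_def)

lemma dim_append_cols [simp]:
  "dim_row (append_cols M N) = dim_row M" "dim_col (append_cols M N) = dim_col M + dim_col N"
  by (auto simp: append_cols_def)

lemma append_cols_carrier:
  "M \<in> carrier_mat nr nc1 \<Longrightarrow> N \<in> carrier_mat nr nc2 \<Longrightarrow> append_cols M N \<in> carrier_mat nr (nc1 + nc2)"
  by (auto simp: append_cols_def)

lemma hcat_Nil [simp]: "hcat nr [] = 0\<^sub>m nr 0"
  and hcat_Cons [simp]: "hcat nr (M # Ms) = append_cols M (hcat nr Ms)"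
  by (simp_all add: hcat_def)

lemma vcat_Nil [simp]: "vcat nc [] = 0\<^sub>m 0 nc"
  and vcat_Cons [simp]: "vcat nc (M # Ms) = M @\<^sub>r vcat nc Ms"
  by (simp_all add: vcat_def)

lemma hcat_carrier:
  assumes "\<And>i. i \<in> set is \<Longrightarrow> F i \<in> carrier_mat nr (d i)"
  shows "hcat nr (map F is) \<in> carrier_mat nr (\<Sum>i\<leftarrow>is. d i)"
  using assms by (induction "is") (simp_all add: append_cols_carrier)

lemma vcat_carrier:
  assumes "\<And>i. i \<in> set is \<Longrightarrow> F i \<in> carrier_mat (d i) nc"
  shows "vcat nc (map F is) \<in> carrier_mat (\<Sum>i\<leftarrow>is. d i) nc"
  using assms by (induction "is") (simp_all add: carrier_append_rows)

lemma index_append_rows: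
  assumes "i < dim_row M + dim_row N" "j < nc" "dim_col M = nc" "dim_col N = nc"
  shows "(M @\<^sub>r N) $$ (i, j) = (if i < dim_row M then M $$ (i, j) else N $$ (i - dim_row M, j))"
  using assms by (auto simp: append_rows_def)

text \<open>Collects a sum such as that of the \<open>B i * K i * C i\<close> into one product of
  concatenations, the form in which it occurs in the transfer matrix and in products with a
  pencil.\<close>

lemma hcat_mult_vcat:
  fixes F G :: "'i \<Rightarrow> 'a :: comm_ring_1 mat"
  assumes "distinct is" and "\<And>i. i \<in> set is \<Longrightarrow> F i \<in> carrier_mat nr (d i)"
    and "\<And>i. i \<in> set is \<Longrightarrow> G i \<in> carrier_mat (d i) nc"
  shows "hcat nr (map F is) * vcat nc (map G is) = mat_sum nr nc (\<lambda>i. F i * G i) (set is)"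
  using assms
proof (induction "is")
  case Nil
  then show ?case by (auto simp: mat_sum_def scalar_prod_def)
next
  case (Cons k "is")
  define H where "H = hcat nr (map F is)"
  define V where "V = vcat nc (map G is)"
  have H: "H \<in> carrier_mat nr (\<Sum>i\<leftarrow>is. d i)" and V: "V \<in> carrier_mat (\<Sum>i\<leftarrow>is. d i) nc"
    unfolding H_def V_def using Cons.prems by (auto intro!: hcat_carrier vcat_carrier)
  have Fk: "F k \<in> carrier_mat nr (d k)" and Gk: "G k \<in> carrier_mat (d k) nc"
    using Cons.prems by auto
  \<comment> \<open>Both concatenations are four-block matrices with empty blocks, so the four-block
    product rule applies and leaves only the upper left block nonempty.\<close>
  have "append_cols (F k) H * (G k @\<^sub>r V) =
      four_block_mat (F k * G k + H * V) (F k * 0\<^sub>m (d k) 0 + H * 0\<^sub>m (\<Sum>i\<leftarrow>is. d i) 0)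
        (0\<^sub>m 0 (d k) * G k + 0\<^sub>m 0 (\<Sum>i\<leftarrow>is. d i) * V)
        (0\<^sub>m 0 (d k) * 0\<^sub>m (d k) 0 + 0\<^sub>m 0 (\<Sum>i\<leftarrow>is. d i) * 0\<^sub>m (\<Sum>i\<leftarrow>is. d i) 0)"
    unfolding append_cols_def append_rows_def using Fk Gk H V
    by (subst mult_four_block_mat[of _ nr "d k" _ "\<Sum>i\<leftarrow>is. d i" _ 0 _ _ nc _ 0]) auto
  also have "\<dots> = F k * G k + H * V"
    using Fk Gk H V by (intro eq_matI) auto
  also have "H * V = mat_sum nr nc (\<lambda>i. F i * G i) (set is)"
    unfolding H_def V_def using Cons by simp
  also have "F k * G k + \<dots> = mat_sum nr nc (\<lambda>i. F i * G i) (set (k # is))"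
    using Cons.prems(1) Fk Gk by (intro eq_matI) (auto simp: mat_sum_def)
  finally show ?case by (simp add: H_def V_def)
qed

lemma map_mat_hcat:
  assumes "f 0 = 0" and "\<And>i. i \<in> set is \<Longrightarrow> F i \<in> carrier_mat nr (d i)"
  shows "map_mat f (hcat nr (map F is)) = hcat nr (map (\<lambda>i. map_mat f (F i)) is)"
  using assms(2)
proof (induction "is")
  case (Cons k "is")
  have H: "hcat nr (map F is) \<in> carrier_mat nr (\<Sum>i\<leftarrow>is. d i)" using Cons.prems by (auto intro!: hcat_carrier)
  have "map_mat f (append_cols (F k) (hcat nr (map F is))) =
      append_cols (map_mat f (F k)) (map_mat f (hcat nr (map F is)))"
    using Cons.prems[of k] H by (intro eq_matI) (auto simp: index_append_cols)
  then show ?case using Cons by simp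
qed (auto simp: assms(1))

lemma map_mat_vcat:
  assumes "f 0 = 0" and "\<And>i. i \<in> set is \<Longrightarrow> F i \<in> carrier_mat (d i) nc"
  shows "map_mat f (vcat nc (map F is)) = vcat nc (map (\<lambda>i. map_mat f (F i)) is)"
  using assms(2)
proof (induction "is")
  case (Cons k "is")
  have H: "vcat nc (map F is) \<in> carrier_mat (\<Sum>i\<leftarrow>is. d i) nc" using Cons.prems by (auto intro!: vcat_carrier)
  have Fk: "F k \<in> carrier_mat (d k) nc" using Cons.prems by simp
  have "map_mat f (F k @\<^sub>r vcat nc (map F is)) = map_mat f (F k) @\<^sub>r map_mat f (vcat nc (map F is))"
    unfolding append_rows_def using Fk H by (intro eq_matI) auto
  then show ?case using Cons by simp
qed (auto simp: assms(1))

text \<open>Traces each border column of a pencil back to a column of a single \<open>B i\<close>,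
  and so to a gain entry that carries it.\<close>

lemma hcat_column:
  assumes "\<And>i. i \<in> set is \<Longrightarrow> F i \<in> carrier_mat nr (d i)" and "j < dim_col (hcat nr (map F is))"
  shows "\<exists>i \<in> set is. \<exists>a < d i. \<forall>s < nr. hcat nr (map F is) $$ (s, j) = F i $$ (s, a)"
  using assms
proof (induction "is" arbitrary: j)
  case (Cons k "is")
  have H: "hcat nr (map F is) \<in> carrier_mat nr (\<Sum>i\<leftarrow>is. d i)" using Cons.prems by (auto intro!: hcat_carrier)
  have Fk: "F k \<in> carrier_mat nr (d k)" using Cons.prems by simp
  show ?case
  proof (cases "j < d k")
    case True
    then have "\<forall>s < nr. hcat nr (map F (k # is)) $$ (s, j) = F k $$ (s, j)"
      using Fk H by (auto simp: index_append_cols)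
    with True show ?thesis by auto
  next
    case False
    then have eq: "\<forall>s < nr. hcat nr (map F (k # is)) $$ (s, j) = hcat nr (map F is) $$ (s, j - d k)"
      using Fk H Cons.prems(2) by (auto simp: index_append_cols)
    have "j - d k < dim_col (hcat nr (map F is))" using Cons.prems(2) False Fk by auto
    with Cons.IH[of "j - d k"] Cons.prems(1) obtain i a where "i \<in> set is" "a < d i"
      "\<forall>s < nr. hcat nr (map F is) $$ (s, j - d k) = F i $$ (s, a)"
      by auto
    with eq show ?thesis by auto
  qed
qed simp

text \<open>The analogue for border rows and the rows of the \<open>C i\<close>.\<close>

lemma vcat_row:
  assumes "\<And>i. i \<in> set is \<Longrightarrow> F i \<in> carrier_mat (d i) nc" and "j < dim_row (vcat nc (map F is))"
  shows "\<exists>i \<in> set is. \<exists>a < d i. \<forall>t < nc. vcat nc (map F is) $$ (j, t) = F i $$ (a, t)"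
  using assms
proof (induction "is" arbitrary: j)
  case (Cons k "is")
  have H: "vcat nc (map F is) \<in> carrier_mat (\<Sum>i\<leftarrow>is. d i) nc" using Cons.prems by (auto intro!: vcat_carrier)
  have Fk: "F k \<in> carrier_mat (d k) nc" using Cons.prems by simp
  have dim: "dim_row (vcat nc (map F (k # is))) = d k + dim_row (vcat nc (map F is))"
    using Fk by (simp add: append_rows_def)
  show ?case
  proof (cases "j < d k")
    case True
    then have "\<forall>t < nc. vcat nc (map F (k # is)) $$ (j, t) = F k $$ (j, t)"
      using Fk H by (auto simp: index_append_rows)
    with True show ?thesis by auto
  next
    case False
    then have eq: "\<forall>t < nc. vcat nc (map F (k # is)) $$ (j, t) = vcat nc (map F is) $$ (j - d k, t)"
      using Fk H Cons.prems(2) dim by (auto simp: index_append_rows)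
    have "j - d k < dim_row (vcat nc (map F is))" using Cons.prems(2) False dim by auto
    with Cons.IH[of "j - d k"] Cons.prems(1) obtain i a where "i \<in> set is" "a < d i"
      "\<forall>t < nc. vcat nc (map F is) $$ (j - d k, t) = F i $$ (a, t)"
      by auto
    with eq show ?thesis by auto
  qed
qed simp

text \<open>The sum is the bordered matrix multiplied by \<open>[1, X]\<close> from the left and
  \<open>[1; Y]\<close> from the right, and multiplication does not increase the rank.\<close>

lemma mrank_bordered_ge:
  fixes M :: "'a :: field mat"
  assumes M: "M \<in> carrier_mat m m" and B: "B \<in> carrier_mat m p" and C: "C \<in> carrier_mat s m"
    and X: "X \<in> carrier_mat m s" and Y: "Y \<in> carrier_mat p m"
  shows "mrank (M + B * Y + X * C) \<le> mrank (four_block_mat M B C (0\<^sub>m s p))"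
proof -
  let ?P = "four_block_mat M B C (0\<^sub>m s p)"
  let ?X = "append_cols (1\<^sub>m m) X" and ?Y = "1\<^sub>m m @\<^sub>r Y"
  have "?X * ?P = append_cols (M + X * C) B"
    unfolding append_cols_def using M B C X
    by (subst mult_four_block_mat[of _ m m _ s _ 0 _ _ m _ p]) (auto intro!: cong_four_block_mat)
  moreover have "append_cols (M + X * C) B * ?Y = M + X * C + B * Y"
    unfolding append_cols_def append_rows_def using M B C X Y
    by (subst mult_four_block_mat[of _ m m _ p _ 0 _ _ m _ 0]) (auto intro!: eq_matI)
  moreover have "M + X * C + B * Y = M + B * Y + X * C"
    using M B C X Y by (intro eq_matI) auto
  ultimately have "?X * ?P * ?Y = M + B * Y + X * C" by simp
  moreover have "mrank (?X * ?P * ?Y) \<le> mrank ?P"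
    using M B C X Y by (intro mrank_mult_le[of _ m "m + s" _ "m + p" _ m]) (auto intro!: append_cols_carrier)
  ultimately show ?thesis by simp
qed

subsection \<open>Choosing the gains\<close>

text \<open>Exhibits \<open>F * K * G\<close> as a combination of rank-one terms, column
  \<open>a\<close> of \<open>F\<close> times row \<open>b\<close> of \<open>G\<close>, with the
  entries of \<open>K\<close> as scalars.\<close>

lemma index_triple_mult:
  fixes F :: "'a :: comm_ring_1 mat"
  assumes "F \<in> carrier_mat m q" "K \<in> carrier_mat q r" "G \<in> carrier_mat r m" "s < m" "t < m"
  shows "(F * K * G) $$ (s, t) = (\<Sum>a<q. \<Sum>b<r. K $$ (a, b) * F $$ (s, a) * G $$ (b, t))"
  using assms
  by (simp add: scalar_prod_def sum_distrib_right sum_distrib_left lessThan_atLeast0 ac_simps)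

text \<open>Every entry of a gain matrix is treated as a separate scalar gain. A set \<open>S\<close> of entries
  either meets every column of \<open>B i\<close>, or its complement meets every row of \<open>C i\<close>; so its
  bordered matrix contains, up to zero and repeated rows and columns, the pencil of the set \<open>V\<close>
  of those \<open>i\<close> for which the former holds.\<close>

theorem pencils_full_rank_imp_gain:
  fixes M :: "'a :: field mat" and B C :: "'i :: linorder \<Rightarrow> 'a mat"
  assumes inf: "infinite (UNIV :: 'a set)" and fin: "finite I" and M: "M \<in> carrier_mat m m"
    and B: "\<And>i. i \<in> I \<Longrightarrow> B i \<in> carrier_mat m (q i)"
    and C: "\<And>i. i \<in> I \<Longrightarrow> C i \<in> carrier_mat (r i) m"
    and ranks: "\<And>V BV CV. V \<subseteq> I \<Longrightarrow> BV = hcat m (map B (sorted_list_of_set V)) \<Longrightarrow>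
      CV = vcat m (map C (sorted_list_of_set (I - V))) \<Longrightarrow>
      m \<le> mrank (four_block_mat M BV CV (0\<^sub>m (dim_row CV) (dim_col BV)))"
  shows "\<exists>K. (\<forall>i \<in> I. K i \<in> carrier_mat (q i) (r i)) \<and> det (M + mat_sum m m (\<lambda>i. B i * K i * C i) I) \<noteq> 0"
proof -
  define E where "E = (SIGMA i:I. {..<q i} \<times> {..<r i})"
  have finE: "finite E" using fin by (simp add: E_def)
  define N where "N = card E"
  \<comment> \<open>Each position \<open>(i, a, a')\<close> of a gain entry gets its own border
    coordinate \<open>m + idx e\<close>.\<close>
  obtain idx where idx: "bij_betw idx E {..<N}"
    using ex_bij_betw_finite_nat[OF finE] by (auto simp: N_def atLeast0LessThan)
  have idx_less: "idx e < N" if "e \<in> E" for e using idx that by (auto simp: bij_betw_def)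
  have idx_inj: "idx e = idx e' \<longleftrightarrow> e = e'" if "e \<in> E" "e' \<in> E" for e e'
    using idx that by (auto simp: bij_betw_def inj_on_def)
  \<comment> \<open>\<open>b e\<close> is a column of \<open>B i\<close> and \<open>c e\<close> a
    row of \<open>C i\<close>, extended by zero along the border; \<open>x e\<close> and
    \<open>y e\<close> are the unit vector of the border coordinate of \<open>e\<close>. So
    \<open>b e\<close> times \<open>x e\<close> writes a column of \<open>B i\<close> into the
    border, and \<open>y e\<close> times \<open>c e\<close> a row of \<open>C i\<close>.\<close>
  define b where "b = (\<lambda>(i, a :: nat, _ :: nat) s. if s < m then B i $$ (s, a) else 0)"
  define c where "c = (\<lambda>(i, _ :: nat, a :: nat) t. if t < m then C i $$ (a, t) else 0)"
  define x where "x = (\<lambda>e t. if t = m + idx e then 1 else 0 :: 'a)"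
  define y where "y = x"
  define Q where "Q = mat (m + N) (m + N) (\<lambda>(i, j). if i < m \<and> j < m then M $$ (i, j) else 0)"
  have b0: "b e i = 0" and c0: "c e i = 0" if "\<not> i < m" for e i
    using that by (auto simp: b_def c_def split: prod.split)
  have "\<exists>k. m \<le> mrank (mat (m + N) (m + N) (\<lambda>(i, j). Q $$ (i, j) + (\<Sum>e\<in>E. k e * b e i * c e j)))"
  proof (rule rank_one_terms_gain[OF inf finE, where x = x and y = y])
    fix S assume S: "S \<subseteq> E"
    define W where "W = mat (m + N) (m + N) (\<lambda>(i, j). Q $$ (i, j) + (\<Sum>e\<in>S. b e i * x e j) + (\<Sum>e\<in>E - S. y e i * c e j))"
    have finS: "finite S" using S finE finite_subset by blast
    define V where "V = {i \<in> I. \<forall>a < q i. \<exists>a' < r i. (i, a, a') \<in> S}"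
    have V: "V \<subseteq> I" by (auto simp: V_def)
    have finV: "finite V" "finite (I - V)" using V fin finite_subset by auto
    define BV where "BV = hcat m (map B (sorted_list_of_set V))"
    define CV where "CV = vcat m (map C (sorted_list_of_set (I - V)))"
    have BI: "B i \<in> carrier_mat m (q i)" if "i \<in> set (sorted_list_of_set V)" for i
      using that B V finV by auto
    have CI: "C i \<in> carrier_mat (r i) m" if "i \<in> set (sorted_list_of_set (I - V))" for i
      using that C finV by auto
    have BV: "BV \<in> carrier_mat m (dim_col BV)" and CV: "CV \<in> carrier_mat (dim_row CV) m"
      using hcat_carrier[of "sorted_list_of_set V" B m q, OF BI]
        vcat_carrier[of "sorted_list_of_set (I - V)" C r m, OF CI] unfolding BV_def CV_def by auto
    have "\<exists>e \<in> S. \<forall>s < m. BV $$ (s, j) = b e s" if j: "j < dim_col BV" for j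
    proof -
      obtain i a where i: "i \<in> V" and a: "a < q i" and eq: "\<forall>s < m. BV $$ (s, j) = B i $$ (s, a)"
        using hcat_column[of "sorted_list_of_set V" B m q j, OF BI, folded BV_def, OF _ j]
        unfolding set_sorted_list_of_set[OF finV(1)] by blast
      obtain a' where "(i, a, a') \<in> S" using i a unfolding V_def by blast
      then show ?thesis using eq by (intro bexI[of _ "(i, a, a')"]) (auto simp: b_def)
    qed
    then obtain f where f: "\<And>j. j < dim_col BV \<Longrightarrow> f j \<in> S"
      "\<And>j s. j < dim_col BV \<Longrightarrow> s < m \<Longrightarrow> BV $$ (s, j) = b (f j) s" by metis
    have "\<exists>e \<in> E - S. \<forall>t < m. CV $$ (j, t) = c e t" if j: "j < dim_row CV" for j
    proof -
      obtain i a' where i: "i \<in> I - V" and a': "a' < r i" and eq: "\<forall>t < m. CV $$ (j, t) = C i $$ (a', t)"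
        using vcat_row[of "sorted_list_of_set (I - V)" C r m j, OF CI, folded CV_def, OF _ j]
        unfolding set_sorted_list_of_set[OF finV(2)] by blast
      \<comment> \<open>As \<open>i\<close> is not in \<open>V\<close>, some column index
        \<open>a\<close> is missed by \<open>S\<close> for every \<open>a'\<close>.\<close>
      obtain a where "a < q i" "(i, a, a') \<notin> S" using i a' unfolding V_def by blast
      then show ?thesis using eq i a' by (intro bexI[of _ "(i, a, a')"]) (auto simp: c_def E_def)
    qed
    then obtain g where g: "\<And>j. j < dim_row CV \<Longrightarrow> g j \<in> E - S"
      "\<And>j t. j < dim_row CV \<Longrightarrow> t < m \<Longrightarrow> CV $$ (j, t) = c (g j) t" by metis
    have fE: "f j \<in> E" if "j < dim_col BV" for j using f(1)[OF that] S by auto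
    have gE: "g j \<in> E" if "j < dim_row CV" for j using g(1)[OF that] by auto
    \<comment> \<open>\<open>F\<close> and \<open>G\<close> send the columns and rows of the pencil
      to the coordinates of \<open>W\<close> where copies of them stand; a border coordinate may be
      hit more than once.\<close>
    define F where "F = (\<lambda>j. if j < m then j else m + idx (f (j - m)))"
    define G where "G = (\<lambda>i. if i < m then i else m + idx (g (i - m)))"
    have F: "F j < m + N" if "j < m + dim_col BV" for j
      using that fE[of "j - m"] idx_less by (auto simp: F_def)
    have G: "G i < m + N" if "i < m + dim_row CV" for i
      using that gE[of "i - m"] idx_less by (auto simp: G_def)
    \<comment> \<open>Distinct positions have distinct border coordinates, so on the border only the
      term of \<open>f (j - m)\<close> survives.\<close>
    have sumF: "(\<Sum>e\<in>S. b e i * x e (F j)) = (if j < m then 0 else b (f (j - m)) i)"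
      if j: "j < m + dim_col BV" for i j
    proof (cases "j < m")
      case False
      then have fj: "f (j - m) \<in> S" using f(1) j by auto
      have "(\<Sum>e\<in>S. b e i * x e (F j)) = (\<Sum>e\<in>S. if f (j - m) = e then b e i else 0)"
      proof (rule sum.cong[OF refl])
        fix e assume "e \<in> S"
        then have "idx (f (j - m)) = idx e \<longleftrightarrow> f (j - m) = e" using idx_inj fj S by blast
        then show "b e i * x e (F j) = (if f (j - m) = e then b e i else 0)"
          using False by (simp add: F_def x_def)
      qed
      then show ?thesis using False fj finS by simp
    qed (auto simp: F_def x_def)
    have sumG: "(\<Sum>e\<in>E - S. y e (G i) * c e j) = (if i < m then 0 else c (g (i - m)) j)"
      if i: "i < m + dim_row CV" for i j
    proof (cases "i < m")
      case False
      then have gi: "g (i - m) \<in> E - S" using g(1) i by auto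
      have "(\<Sum>e\<in>E - S. y e (G i) * c e j) = (\<Sum>e\<in>E - S. if g (i - m) = e then c e j else 0)"
      proof (rule sum.cong[OF refl])
        fix e assume "e \<in> E - S"
        then have "idx (g (i - m)) = idx e \<longleftrightarrow> g (i - m) = e" using idx_inj gi by blast
        then show "y e (G i) * c e j = (if g (i - m) = e then c e j else 0)"
          using False by (simp add: G_def x_def y_def)
      qed
      then show ?thesis using False gi finE by simp
    qed (auto simp: G_def x_def y_def)
    have "four_block_mat M BV CV (0\<^sub>m (dim_row CV) (dim_col BV)) =
        mat (m + dim_row CV) (m + dim_col BV) (\<lambda>(i, j). W $$ (G i, F j))"
    proof (rule eq_matI, goal_cases)
      case (1 i j)
      then have ij: "i < m + dim_row CV" "j < m + dim_col BV" by auto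
      have "W $$ (G i, F j) = Q $$ (G i, F j) + (if j < m then 0 else b (f (j - m)) (G i))
          + (if i < m then 0 else c (g (i - m)) (F j))"
        using F[OF ij(2)] G[OF ij(1)] ij by (simp add: W_def sumF sumG)
      also have "\<dots> = four_block_mat M BV CV (0\<^sub>m (dim_row CV) (dim_col BV)) $$ (i, j)"
      proof -
        have Qval: "Q $$ (G i, F j) = (if i < m \<and> j < m then M $$ (i, j) else 0)"
          using F[OF ij(2)] G[OF ij(1)] by (auto simp: Q_def) (auto simp: F_def G_def split: if_splits)
        have block: "four_block_mat M BV CV (0\<^sub>m (dim_row CV) (dim_col BV)) $$ (i, j) =
            (if i < m then if j < m then M $$ (i, j) else BV $$ (i, j - m)
             else if j < m then CV $$ (i - m, j) else 0)"
          using ij M by simp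
        have Gi: "i < m \<Longrightarrow> G i = i" "\<not> i < m \<Longrightarrow> \<not> G i < m"
          and Fj: "j < m \<Longrightarrow> F j = j" "\<not> j < m \<Longrightarrow> \<not> F j < m"
          by (auto simp: F_def G_def)
        show ?thesis
        proof (cases "i < m"; cases "j < m")
          assume "i < m" "j < m"
          then show ?thesis unfolding Qval block by simp
        next
          assume "i < m" "\<not> j < m"
          then show ?thesis using f(2)[of "j - m" i] ij unfolding Qval block by (simp add: Gi)
        next
          assume "\<not> i < m" "j < m"
          then show ?thesis using g(2)[of "i - m" j] ij unfolding Qval block by (simp add: Fj)
        next
          \<comment> \<open>The corner block is zero because every \<open>b e\<close> and
            \<open>c e\<close> vanishes on the border.\<close>
          assume "\<not> i < m" "\<not> j < m"
          then show ?thesis using Gi(2) Fj(2) unfolding Qval block by (simp add: b0 c0)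
        qed
      qed
      finally show ?case using ij by simp
    qed (use M in auto)
    moreover have "W \<in> carrier_mat (m + N) (m + N)" by (simp add: W_def)
    ultimately have "mrank (four_block_mat M BV CV (0\<^sub>m (dim_row CV) (dim_col BV))) \<le> mrank W"
      using mrank_reindex_le[of W "m + N" "m + N" "m + dim_row CV" G "m + dim_col BV" F] F G by simp
    with ranks[OF V BV_def CV_def] show "m \<le> mrank W" by simp
  qed (simp add: Q_def)
  then obtain k where k: "m \<le> mrank (mat (m + N) (m + N) (\<lambda>(i, j). Q $$ (i, j) + (\<Sum>e\<in>E. k e * b e i * c e j)))"
    by blast
  define K where "K = (\<lambda>i. mat (q i) (r i) (\<lambda>(a, a'). k (i, a, a')))"
  have K: "K i \<in> carrier_mat (q i) (r i)" for i by (simp add: K_def)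
  define M' where "M' = M + mat_sum m m (\<lambda>i. B i * K i * C i) I"
  have M': "M' \<in> carrier_mat m m" using M by (simp add: M'_def mat_sum_def)
  have sumE: "(\<Sum>e\<in>E. k e * b e s * c e t) = (\<Sum>i\<in>I. (B i * K i * C i) $$ (s, t))" if "s < m" "t < m" for s t
  proof -
    have "(\<Sum>e\<in>E. k e * b e s * c e t) =
        (\<Sum>i\<in>I. \<Sum>a<q i. \<Sum>a'<r i. k (i, a, a') * b (i, a, a') s * c (i, a, a') t)"
      unfolding E_def using fin by (simp add: sum.Sigma sum.cartesian_product split_def)
    also have "\<dots> = (\<Sum>i\<in>I. (B i * K i * C i) $$ (s, t))"
    proof (rule sum.cong[OF refl])
      fix i assume i: "i \<in> I"
      show "(\<Sum>a<q i. \<Sum>a'<r i. k (i, a, a') * b (i, a, a') s * c (i, a, a') t) = (B i * K i * C i) $$ (s, t)"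
        unfolding index_triple_mult[OF B[OF i] K C[OF i] that] using that
        by (simp add: K_def b_def c_def)
    qed
    finally show ?thesis .
  qed
  \<comment> \<open>With all gains fixed no unit vector is left, and the border is zero.\<close>
  have "mat (m + N) (m + N) (\<lambda>(i, j). Q $$ (i, j) + (\<Sum>e\<in>E. k e * b e i * c e j)) =
      mat (m + N) (m + N) (\<lambda>(i, j). if i < m \<and> j < m then M' $$ (i, j) else 0)"
    using M by (intro eq_matI) (auto simp: Q_def M'_def mat_sum_def sumE b0 c0)
  with k mrank_zero_border[OF M' refl, of N] have "m \<le> mrank M'" by simp
  then have "det M' \<noteq> 0" using mrank_eq_dim_iff_det[OF M'] by simp
  then show ?thesis using K unfolding M'_def by (intro exI[of _ K]) simp
qed

subsection \<open>Evaluating the indeterminates\<close>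

definition monom_eval :: "(nat \<Rightarrow> 'a) \<Rightarrow> (nat \<Rightarrow>\<^sub>0 nat) \<Rightarrow> 'a :: comm_semiring_1" where
  "monom_eval f t = (\<Prod>x \<in> Poly_Mapping.keys t. f x ^ Poly_Mapping.lookup t x)"

definition mpoly_eval :: "(nat \<Rightarrow> 'a) \<Rightarrow> ((nat \<Rightarrow>\<^sub>0 nat) \<Rightarrow>\<^sub>0 'a) \<Rightarrow> 'a :: comm_semiring_1" where
  "mpoly_eval f p = (\<Sum>t \<in> Poly_Mapping.keys p. Poly_Mapping.lookup p t * monom_eval f t)"

lemma monom_eval_superset:
  assumes "finite A" "Poly_Mapping.keys t \<subseteq> A"
  shows "monom_eval f t = (\<Prod>x \<in> A. f x ^ Poly_Mapping.lookup t x)"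
  unfolding monom_eval_def using assms
  by (intro prod.mono_neutral_left) (auto simp: in_keys_iff)

lemma monom_eval_add: "monom_eval f (s + t) = monom_eval f s * monom_eval f t"
proof -
  let ?A = "Poly_Mapping.keys s \<union> Poly_Mapping.keys t"
  have "monom_eval f (s + t) = (\<Prod>x \<in> ?A. f x ^ Poly_Mapping.lookup (s + t) x)"
    by (rule monom_eval_superset) (auto simp: in_keys_iff lookup_add)
  also have "\<dots> = (\<Prod>x \<in> ?A. f x ^ Poly_Mapping.lookup s x) * (\<Prod>x \<in> ?A. f x ^ Poly_Mapping.lookup t x)"
    by (simp add: lookup_add power_add prod.distrib)
  also have "\<dots> = monom_eval f s * monom_eval f t"
    by (simp add: monom_eval_superset[of ?A])
  finally show ?thesis .
qed

lemma mpoly_eval_superset: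
  assumes "finite A" "Poly_Mapping.keys p \<subseteq> A"
  shows "mpoly_eval f p = (\<Sum>t \<in> A. Poly_Mapping.lookup p t * monom_eval f t)"
  unfolding mpoly_eval_def using assms
  by (intro sum.mono_neutral_left) (auto simp: in_keys_iff)

lemma mpoly_eval_add: "mpoly_eval f (p + q) = mpoly_eval f p + mpoly_eval f q"
proof -
  let ?A = "Poly_Mapping.keys p \<union> Poly_Mapping.keys q"
  have "mpoly_eval f (p + q) = (\<Sum>t \<in> ?A. Poly_Mapping.lookup (p + q) t * monom_eval f t)"
    by (rule mpoly_eval_superset) (auto simp: in_keys_iff lookup_add)
  also have "\<dots> = (\<Sum>t \<in> ?A. Poly_Mapping.lookup p t * monom_eval f t) + (\<Sum>t \<in> ?A. Poly_Mapping.lookup q t * monom_eval f t)"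
    by (simp add: lookup_add distrib_right sum.distrib)
  also have "\<dots> = mpoly_eval f p + mpoly_eval f q"
    by (simp add: mpoly_eval_superset[of ?A])
  finally show ?thesis .
qed

lemma mpoly_eval_single: "mpoly_eval f (Poly_Mapping.single t c) = c * monom_eval f t"
  by (simp add: mpoly_eval_superset[of "{t}"])

text \<open>Updating at a fresh key is the same as adding a single term. In this additive form,
  distributivity reduces multiplicativity of the evaluation to single terms.\<close>

lemma poly_mapping_add_single_induct [case_names zero add]:
  assumes "P 0" and "\<And>p t c. P p \<Longrightarrow> P (p + Poly_Mapping.single t c)"
  shows "P (p :: 'k \<Rightarrow>\<^sub>0 'a :: comm_monoid_add)"
proof (induction p rule: update_induct)
  case (update p t c)
  have "Poly_Mapping.update t c p = p + Poly_Mapping.single t c"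
    using update(1) by (intro poly_mapping_eqI) (auto simp: lookup_update lookup_add lookup_single in_keys_iff when_def)
  then show ?case using assms(2)[OF update(3)] by simp
qed (rule assms(1))

lemma mpoly_eval_mult: "mpoly_eval f (p * q) = mpoly_eval f p * mpoly_eval f q"
proof (induction p rule: poly_mapping_add_single_induct)
  case zero
  then show ?case by (simp add: mpoly_eval_def)
next
  case (add p t c)
  have "mpoly_eval f (Poly_Mapping.single t c * q) = c * monom_eval f t * mpoly_eval f q"
  proof (induction q rule: poly_mapping_add_single_induct)
    case zero
    then show ?case by (simp add: mpoly_eval_def)
  next
    case (add q s d)
    then show ?case
      by (simp add: distrib_left mult_single mpoly_eval_add mpoly_eval_single monom_eval_add ac_simps)
  qed
  with add show ?case
    by (simp add: distrib_right mpoly_eval_add mpoly_eval_single)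
qed

lemma mpoly_eval_const: "mpoly_eval f (Poly_Mapping.single 0 c) = c"
  by (simp add: mpoly_eval_single monom_eval_def)

lemma mpoly_eval_var:
  "mpoly_eval f (Poly_Mapping.single (Poly_Mapping.single x 1) 1) = f x"
  by (simp add: mpoly_eval_single monom_eval_def)

lemma mpoly_eval_hom: "comm_ring_hom (mpoly_eval f :: _ \<Rightarrow> 'a :: comm_ring_1)"
  by unfold_locales
    (simp_all add: mpoly_eval_add mpoly_eval_mult mpoly_eval_const[of f 1, simplified] mpoly_eval_const[of f 0, simplified])

lemma Fract_one_hom: "comm_ring_hom (\<lambda>p :: 'a :: idom. Fract p 1)"
  by unfold_locales (simp_all add: Zero_fract_def One_fract_def)

lemma const_rat_hom: "comm_ring_hom const_rat"
  by unfold_locales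
    (simp_all add: const_rat_def Zero_fract_def One_fract_def single_add mult_single)

text \<open>A determinant that vanishes over the fraction field already vanishes as a polynomial.
  Evaluation at the entries of \<open>K\<close> commutes with the determinant and so gives zero as
  well.\<close>

lemma det_G_cn_zero_imp_det_zero:
  assumes A: "A \<in> carrier_mat m m"
    and B: "\<And>i. i \<in> {1..v} \<Longrightarrow> B i \<in> carrier_mat m (q i)"
    and C: "\<And>i. i \<in> {1..v} \<Longrightarrow> C i \<in> carrier_mat (r i) m"
    and K: "\<And>i. i \<in> {1..v} \<Longrightarrow> K i \<in> carrier_mat (q i) (r i)"
    and det0: "det (G_cn m v q r A B C (const_rat l)) = 0"
  shows "det (l \<cdot>\<^sub>m 1\<^sub>m m - A - mat_sum m m (\<lambda>i. B i * K i * C i) {1..v}) = 0"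
proof -
  interpret ev: comm_ring_hom "mpoly_eval f" for f :: "nat \<Rightarrow> complex" by (rule mpoly_eval_hom)
  interpret emb: comm_ring_hom "\<lambda>p :: cpoly. Fract p 1" by (rule Fract_one_hom)
  interpret cr: comm_ring_hom const_rat by (rule const_rat_hom)
  define var :: "nat \<Rightarrow> nat \<Rightarrow> nat \<Rightarrow> cpoly" where
    "var i a b = Poly_Mapping.single (Poly_Mapping.single (prod_encode (i, prod_encode (a, b))) 1) 1" for i a b
  let ?c = "Poly_Mapping.single 0 :: complex \<Rightarrow> cpoly"
  define S where "S s t = (\<Sum>i\<in>{1..v}. \<Sum>a<q i. \<Sum>b<r i. var i a b * ?c (B i $$ (s, a)) * ?c (C i $$ (b, t)))" for s t
  \<comment> \<open>\<open>G\<close> is \<open>G_cn\<close> before the passage to fractions: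
    evaluation is a homomorphism on polynomials, while a fraction may have a pole.\<close>
  define G where "G = mat m m (\<lambda>(s, t). ?c ((l \<cdot>\<^sub>m 1\<^sub>m m - A) $$ (s, t)) - S s t)"
  have "G_cn m v q r A B C (const_rat l) = map_mat (\<lambda>p. Fract p 1) G"
  proof (rule eq_matI, goal_cases)
    case (1 s t)
    then have st: "s < m" "t < m" by (auto simp: G_def)
    have "(const_mat (B i) * gain (q i) (r i) i * const_mat (C i)) $$ (s, t) =
        (\<Sum>a<q i. \<Sum>b<r i. Fract (var i a b * ?c (B i $$ (s, a)) * ?c (C i $$ (b, t))) 1)" if "i \<in> {1..v}" for i
      using B[OF that] C[OF that] st
      by (subst index_triple_mult[of _ m "q i" _ "r i"])
        (auto simp: gain_def const_rat_def indet_def var_def)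
    then have "(\<Sum>i\<in>{1..v}. (const_mat (B i) * gain (q i) (r i) i * const_mat (C i)) $$ (s, t)) =
        Fract (S s t) 1"
      by (simp add: S_def emb.hom_sum)
    moreover have "(const_rat l \<cdot>\<^sub>m 1\<^sub>m m - const_mat A) $$ (s, t) = Fract (?c ((l \<cdot>\<^sub>m 1\<^sub>m m - A) $$ (s, t))) 1"
      using st A by (auto simp: const_rat_def single_diff)
    moreover have "G_cn m v q r A B C (const_rat l) $$ (s, t) = (const_rat l \<cdot>\<^sub>m 1\<^sub>m m - const_mat A) $$ (s, t) -
        (\<Sum>i\<in>{1..v}. (const_mat (B i) * gain (q i) (r i) i * const_mat (C i)) $$ (s, t))"
      unfolding G_cn_def mat_sum_def using st A by simp
    ultimately have "G_cn m v q r A B C (const_rat l) $$ (s, t) =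
        Fract (?c ((l \<cdot>\<^sub>m 1\<^sub>m m - A) $$ (s, t))) 1 - Fract (S s t) 1"
      by simp
    also have "\<dots> = Fract (?c ((l \<cdot>\<^sub>m 1\<^sub>m m - A) $$ (s, t)) - S s t) 1"
      by (rule emb.hom_minus[symmetric])
    also have "\<dots> = map_mat (\<lambda>p. Fract p 1) G $$ (s, t)"
      using st by (simp add: G_def)
    finally show ?case .
  qed (use A in \<open>auto simp: G_cn_def G_def mat_sum_def\<close>)
  then have "Fract (det G) 1 = 0" using det0 by simp
  then have "Fract (det G) 1 = Fract 0 1" unfolding Zero_fract_def .
  then have "det G * 1 = 0 * 1" using eq_fract(1)[OF one_neq_zero one_neq_zero] by blast
  then have "det G = 0" by simp
  \<comment> \<open>\<open>f\<close> undoes the pairing in \<open>gain\<close>, so that each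
    indeterminate takes the value of the matching entry of \<open>K i\<close>.\<close>
  define f where "f x = (case prod_decode x of (i, ab) \<Rightarrow> K i $$ prod_decode ab)" for x
  have "map_mat (mpoly_eval f) G = l \<cdot>\<^sub>m 1\<^sub>m m - A - mat_sum m m (\<lambda>i. B i * K i * C i) {1..v}"
  proof (rule eq_matI, goal_cases)
    case (1 s t)
    then have st: "s < m" "t < m" by (auto simp: mat_sum_def)
    have "mpoly_eval f (var i a b) = K i $$ (a, b)" for i a b
      unfolding var_def mpoly_eval_var by (simp add: f_def)
    then have "mpoly_eval f (S s t) =
        (\<Sum>i\<in>{1..v}. \<Sum>a<q i. \<Sum>b<r i. K i $$ (a, b) * B i $$ (s, a) * C i $$ (b, t))"
      by (simp add: S_def ev.hom_sum ev.hom_mult mpoly_eval_const)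
    also have "\<dots> = (\<Sum>i\<in>{1..v}. (B i * K i * C i) $$ (s, t))"
      using index_triple_mult[OF B K C st] by (intro sum.cong refl) simp
    finally have S: "mpoly_eval f (S s t) = \<dots>" .
    have "map_mat (mpoly_eval f) G $$ (s, t) = mpoly_eval f (?c ((l \<cdot>\<^sub>m 1\<^sub>m m - A) $$ (s, t)) - S s t)"
      using st by (simp add: G_def)
    also have "\<dots> = (l \<cdot>\<^sub>m 1\<^sub>m m - A) $$ (s, t) - mpoly_eval f (S s t)"
      unfolding ev.hom_minus mpoly_eval_const ..
    finally show ?case
      unfolding S mat_sum_def using st A by simp
  qed (use A in \<open>auto simp: G_def mat_sum_def\<close>)
  then have "det (l \<cdot>\<^sub>m 1\<^sub>m m - A - mat_sum m m (\<lambda>i. B i * K i * C i) {1..v}) = mpoly_eval f (det G)"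
    by (metis ev.hom_det)
  then show ?thesis using \<open>det G = 0\<close> by simp
qed

subsection \<open>The network and the pencils\<close>

text \<open>A factorization over the complex numbers remains one after extending the
  scalars.\<close>

lemma mrank_const_mat_le: "mrank (const_mat P) \<le> mrank P"
proof -
  interpret cr: comm_ring_hom const_rat by (rule const_rat_hom)
  define d where "d = mrank P"
  obtain L R where L: "L \<in> carrier_mat (dim_row P) d" and R: "R \<in> carrier_mat d (dim_col P)" and LR: "P = L * R"
    using mrank_le_iff_factor[of P "dim_row P" "dim_col P" d] d_def by blast
  have "const_mat P = const_mat L * const_mat R"
    unfolding LR by (rule cr.mat_hom_mult[OF L R])
  then show ?thesis
    using mrank_mult_le_inner[of "const_mat L" "dim_row P" d "const_mat R" "dim_col P"] L R d_def by simp
qed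

lemma uminus_hcat:
  fixes F :: "'i \<Rightarrow> 'a :: ring mat"
  assumes "\<And>i. i \<in> set is \<Longrightarrow> F i \<in> carrier_mat nr (d i)"
  shows "- hcat nr (map F is) = hcat nr (map (\<lambda>i. - F i) is)"
proof -
  have neg: "map_mat uminus M = - M" for M :: "'a mat" by (rule eq_matI) auto
  show ?thesis using map_mat_hcat[of uminus "is" F nr d] assms by (simp add: neg)
qed

lemma hcat_zero: "hcat nr (map (\<lambda>i. 0\<^sub>m nr (d i)) is) = 0\<^sub>m nr (\<Sum>i\<leftarrow>is. d i)"
  by (induction "is") (auto simp: append_cols_def)

lemma vcat_zero: "vcat nc (map (\<lambda>i. 0\<^sub>m (d i) nc) is) = 0\<^sub>m (\<Sum>i\<leftarrow>is. d i) nc"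
  by (induction "is") (auto simp: append_rows_def)

text \<open>The layout of a cut matrix: a block row \<open>[C i, 0]\<close> for each relay on the
  receiving side, followed by the block row of \<open>Rx\<close>.\<close>

lemma vcat_bordered:
  assumes "\<And>i. i \<in> set is \<Longrightarrow> F i \<in> carrier_mat (d i) nc" and M: "M \<in> carrier_mat nr nc" and B: "B \<in> carrier_mat nr p"
  shows "vcat (nc + p) (map (\<lambda>i. append_cols (F i) (0\<^sub>m (d i) p)) is @ [append_cols M B]) =
    four_block_mat (vcat nc (map F is)) (0\<^sub>m (\<Sum>i\<leftarrow>is. d i) p) M B"
  using assms(1)
proof (induction "is")
  case Nil
  show ?case using M B by (intro eq_matI) (auto simp: append_rows_def append_cols_def)
next
  case (Cons k "is")
  have V: "vcat nc (map F is) \<in> carrier_mat (\<Sum>i\<leftarrow>is. d i) nc" using Cons.prems by (intro vcat_carrier) auto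
  have Fk: "F k \<in> carrier_mat (d k) nc" using Cons.prems by simp
  have IH: "vcat (nc + p) (map (\<lambda>i. append_cols (F i) (0\<^sub>m (d i) p)) is @ [append_cols M B]) =
    four_block_mat (vcat nc (map F is)) (0\<^sub>m (\<Sum>i\<leftarrow>is. d i) p) M B"
    using Cons by simp
  have "append_cols (F k) (0\<^sub>m (d k) p) @\<^sub>r four_block_mat (vcat nc (map F is)) (0\<^sub>m (\<Sum>i\<leftarrow>is. d i) p) M B =
      four_block_mat (F k @\<^sub>r vcat nc (map F is)) (0\<^sub>m (d k + (\<Sum>i\<leftarrow>is. d i)) p) M B"
    using V Fk M B by (intro eq_matI) (auto simp: append_rows_def append_cols_def)
  then show ?case using IH by simp
qed

text \<open>A cut matrix has the block row of \<open>Rx\<close> at the bottom, a pencil has it on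
  top. Swapping is a reindexing of rows, in both directions.\<close>

lemma mrank_swap_blocks:
  fixes M :: "'a :: field mat"
  assumes M: "M \<in> carrier_mat n nc" and B: "B \<in> carrier_mat n p" and C: "C \<in> carrier_mat s nc" and D: "D \<in> carrier_mat s p"
  shows "mrank (four_block_mat C D M B) = mrank (four_block_mat M B C D)"
proof -
  have le: "mrank (four_block_mat C D M B) \<le> mrank (four_block_mat M B C D)"
    if M: "M \<in> carrier_mat n nc" and B: "B \<in> carrier_mat n p" and C: "C \<in> carrier_mat s nc" and D: "D \<in> carrier_mat s p"
    for M B C D :: "'a mat" and n s
  proof -
    let ?f = "\<lambda>i. if i < s then n + i else i - s"
    have "four_block_mat C D M B = mat (s + n) (nc + p) (\<lambda>(i, j). four_block_mat M B C D $$ (?f i, j))"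
      using that by (intro eq_matI) auto
    moreover have "four_block_mat M B C D \<in> carrier_mat (n + s) (nc + p)" using that by simp
    moreover have "?f i < n + s" if "i < s + n" for i using that by auto
    ultimately show ?thesis
      using mrank_reindex_le[of "four_block_mat M B C D" "n + s" "nc + p" "s + n" ?f "nc + p" "\<lambda>j. j"] by simp
  qed
  show ?thesis using le[OF assms] le[OF C D M B] by simp
qed

text \<open>The matrix here and the characteristic matrix of the closed loop differ by the factor
  -1, so their determinants vanish together.\<close>

lemma fixed_mode_iff_det:
  assumes A: "A \<in> carrier_mat m m"
  shows "fixed_mode m v q r A B C l \<longleftrightarrow>
    (\<forall>K. (\<forall>i\<in>{1..v}. K i \<in> carrier_mat (q i) (r i)) \<longrightarrow>
      det (l \<cdot>\<^sub>m 1\<^sub>m m - A - mat_sum m m (\<lambda>i. B i * K i * C i) {1..v}) = 0)"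
proof -
  have "l \<in> spectrum (A + mat_sum m m (\<lambda>i. B i * K i * C i) {1..v}) \<longleftrightarrow>
      det (l \<cdot>\<^sub>m 1\<^sub>m m - A - mat_sum m m (\<lambda>i. B i * K i * C i) {1..v}) = 0" for K
  proof -
    define T where "T = mat_sum m m (\<lambda>i. B i * K i * C i) {1..v}"
    have T: "T \<in> carrier_mat m m" by (simp add: T_def mat_sum_def)
    have "l \<cdot>\<^sub>m 1\<^sub>m m - A - T = (- 1) \<cdot>\<^sub>m char_matrix (A + T) l"
      using A T by (intro eq_matI) (auto simp: char_matrix_def)
    then have "det (l \<cdot>\<^sub>m 1\<^sub>m m - A - T) = (- 1) ^ m * det (char_matrix (A + T) l)"
      using A T by (simp add: char_matrix_def)
    then show ?thesis
      using eigenvalue_det[of "A + T" m l] A T by (simp add: T_def spectrum_def)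
  qed
  then show ?thesis unfolding fixed_mode_def by simp
qed

lemma mat_inverse_one: "mat_inverse (1\<^sub>m n :: 'a :: field mat) = Some (1\<^sub>m n)"
proof (cases "mat_inverse (1\<^sub>m n :: 'a mat)")
  case None
  then have "(1\<^sub>m n :: 'a mat) \<notin> Units (ring_mat TYPE('a) n ())"
    by (rule mat_inverse(1)[OF one_carrier_mat])
  moreover have "(1\<^sub>m n :: 'a mat) \<in> Units (ring_mat TYPE('a) n ())"
    by (rule det_non_zero_imp_unit) auto
  ultimately show ?thesis by simp
next
  case (Some X)
  then have "1\<^sub>m n * X = 1\<^sub>m n" "X \<in> carrier_mat n n"
    using mat_inverse(2)[OF one_carrier_mat Some] by auto
  with Some show ?thesis by simp
qed

section \<open>The implications between the statements for a fixed system\<close>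

locale decentralized_system =
  fixes m v :: nat and q r :: "nat \<Rightarrow> nat" and A :: "complex mat" and B C :: "nat \<Rightarrow> complex mat" and l :: complex
  assumes A: "A \<in> carrier_mat m m"
    and B: "\<And>i. i \<in> {1..v} \<Longrightarrow> B i \<in> carrier_mat m (q i)"
    and C: "\<And>i. i \<in> {1..v} \<Longrightarrow> C i \<in> carrier_mat (r i) m"
begin

definition M :: "complex mat" where "M = l \<cdot>\<^sub>m 1\<^sub>m m - A"

lemma M: "M \<in> carrier_mat m m"
  unfolding M_def by (rule minus_carrier_mat[OF A])

lemma sub_B_eq:
  assumes "V \<subseteq> {1..v}"
  shows "- sub_B m B V = hcat m (map (\<lambda>i. - B i) (sorted_list_of_set V))"
    and "- sub_B m B V \<in> carrier_mat m (\<Sum>i\<leftarrow>sorted_list_of_set V. q i)"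
proof -
  have BV: "B i \<in> carrier_mat m (q i)" if "i \<in> set (sorted_list_of_set V)" for i
    using that B assms finite_subset[OF assms] by auto
  show eq: "- sub_B m B V = hcat m (map (\<lambda>i. - B i) (sorted_list_of_set V))"
    unfolding sub_B_def by (rule uminus_hcat[OF BV])
  show "- sub_B m B V \<in> carrier_mat m (\<Sum>i\<leftarrow>sorted_list_of_set V. q i)"
    unfolding eq by (rule hcat_carrier) (use BV in auto)
qed

lemma sub_C_carrier:
  assumes "V \<subseteq> {1..v}"
  shows "sub_C m C V \<in> carrier_mat (\<Sum>i\<leftarrow>sorted_list_of_set V. r i) m"
  unfolding sub_C_def by (rule vcat_carrier) (use C assms finite_subset[OF assms] in auto)

lemma pencil_eq:
  assumes "V \<subseteq> {1..v}"
  shows "pencil m v A B C l V = four_block_mat M (- sub_B m B V) (sub_C m C ({1..v} - V))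
    (0\<^sub>m (\<Sum>i\<leftarrow>sorted_list_of_set ({1..v} - V). r i) (\<Sum>i\<leftarrow>sorted_list_of_set V. q i))"
proof -
  have "dim_col (sub_B m B V) = dim_col (- sub_B m B V)" by simp
  then have "dim_col (sub_B m B V) = (\<Sum>i\<leftarrow>sorted_list_of_set V. q i)"
    using sub_B_eq(2)[OF assms] by (metis carrier_matD(2))
  moreover have "dim_row (sub_C m C ({1..v} - V)) = (\<Sum>i\<leftarrow>sorted_list_of_set ({1..v} - V). r i)"
    using sub_C_carrier[of "{1..v} - V"] by (metis Diff_subset carrier_matD(1))
  ultimately show ?thesis by (simp add: pencil_def M_def Let_def)
qed

text \<open>The step from (1) to (5), by contraposition. The gain theorem is applied to
  \<open>- B i\<close>, which matches the sign in the pencil and turns its sum into \<open>M\<close>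
  minus the closed-loop terms.\<close>

lemma pencils_full_rank_imp_not_fixed_mode:
  assumes "\<And>V. V \<subseteq> {1..v} \<Longrightarrow> m \<le> mrank (pencil m v A B C l V)"
  shows "\<not> fixed_mode m v q r A B C l"
proof -
  have "infinite (UNIV :: complex set)" by (rule infinite_UNIV_char_0)
  then have "\<exists>K. (\<forall>i \<in> {1..v}. K i \<in> carrier_mat (q i) (r i)) \<and>
      det (M + mat_sum m m (\<lambda>i. - B i * K i * C i) {1..v}) \<noteq> 0"
  proof (rule pencils_full_rank_imp_gain[OF _ _ M])
    fix V BV CV
    assume V: "V \<subseteq> {1..v}" and BV: "BV = hcat m (map (\<lambda>i. - B i) (sorted_list_of_set V))"
      and CV: "CV = vcat m (map C (sorted_list_of_set ({1..v} - V)))"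
    have eq: "BV = - sub_B m B V" "CV = sub_C m C ({1..v} - V)"
      using sub_B_eq(1)[OF V] BV CV by (simp_all add: sub_C_def)
    then have "dim_col BV = (\<Sum>i\<leftarrow>sorted_list_of_set V. q i)"
      "dim_row CV = (\<Sum>i\<leftarrow>sorted_list_of_set ({1..v} - V). r i)"
      using sub_B_eq(2)[OF V] sub_C_carrier[OF Diff_subset, of V] by auto
    then show "m \<le> mrank (four_block_mat M BV CV (0\<^sub>m (dim_row CV) (dim_col BV)))"
      using assms[OF V] pencil_eq[OF V] eq by simp
  qed (use B C in auto)
  then obtain K where K: "\<And>i. i \<in> {1..v} \<Longrightarrow> K i \<in> carrier_mat (q i) (r i)"
    and det: "det (M + mat_sum m m (\<lambda>i. - B i * K i * C i) {1..v}) \<noteq> 0" by blast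
  have neg: "- B i * K i * C i = - (B i * K i * C i)" if "i \<in> {1..v}" for i
    using B[OF that] C[OF that] K[OF that] by simp
  have "M + mat_sum m m (\<lambda>i. - B i * K i * C i) {1..v} = M - mat_sum m m (\<lambda>i. B i * K i * C i) {1..v}"
  proof (rule eq_matI, goal_cases)
    case (1 s t)
    then have st: "s < m" "t < m" by (auto simp: mat_sum_def)
    have "(\<Sum>i = 1..v. (- B i * K i * C i) $$ (s, t)) = (\<Sum>i = 1..v. - (B i * K i * C i) $$ (s, t))"
    proof (rule sum.cong[OF refl])
      fix i assume i: "i \<in> {1..v}"
      show "(- B i * K i * C i) $$ (s, t) = - (B i * K i * C i) $$ (s, t)"
        unfolding neg[OF i] using B[OF i] C[OF i] st by simp
    qed
    then show ?case using st M by (simp add: mat_sum_def sum_negf)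
  qed (use M in \<open>auto simp: mat_sum_def\<close>)
  with det K show ?thesis unfolding fixed_mode_iff_det[OF A] M_def by metis
qed

lemma index_neg_gain_term:
  assumes "i \<in> {1..v}" "K \<in> carrier_mat (q i) (r i)" "a < m" "b < m"
  shows "(const_mat (- B i) * K * const_mat (C i)) $$ (a, b) = - (const_mat (B i) * K * const_mat (C i)) $$ (a, b)"
proof -
  interpret cr: comm_ring_hom const_rat by (rule const_rat_hom)
  have "const_mat (- B i) = - const_mat (B i)" by (rule eq_matI) (auto simp: cr.hom_uminus)
  then have "const_mat (- B i) * K * const_mat (C i) = - (const_mat (B i) * K * const_mat (C i))"
    using B[OF assms(1)] C[OF assms(1)] assms(2) by simp
  then show ?thesis using assms B[OF assms(1)] C[OF assms(1)] by simp
qed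

text \<open>The step from (5) to (2): the terms with index in \<open>V\<close> are produced by the
  border columns, the others by the border rows.\<close>

lemma mrank_G_cn_le_pencil:
  assumes V: "V \<subseteq> {1..v}"
  shows "mrank (G_cn m v q r A B C (const_rat l)) \<le> mrank (pencil m v A B C l V)"
proof -
  interpret cr: comm_ring_hom const_rat by (rule const_rat_hom)
  define VC where "VC = {1..v} - V"
  have VC: "VC \<subseteq> {1..v}" by (auto simp: VC_def)
  have fin: "finite V" "finite VC" using V VC finite_subset by auto
  define K where "K = (\<lambda>i. gain (q i) (r i) i)"
  have K: "K i \<in> carrier_mat (q i) (r i)" for i by (simp add: K_def gain_def)
  define p where "p = (\<Sum>i\<leftarrow>sorted_list_of_set V. q i)"
  define s where "s = (\<Sum>i\<leftarrow>sorted_list_of_set VC. r i)"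
  define BV where "BV = const_mat (- sub_B m B V)"
  define CV where "CV = const_mat (sub_C m C VC)"
  have BV: "BV \<in> carrier_mat m p" and CV: "CV \<in> carrier_mat s m"
    using sub_B_eq(2)[OF V] sub_C_carrier[OF VC] by (auto simp: BV_def CV_def p_def s_def)
  \<comment> \<open>\<open>Y\<close> supplies the factors \<open>K i * C i\<close> missing from the
    border columns \<open>- B i\<close>, and \<open>X\<close> the factors \<open>- B i * K i\<close>
    missing from the border rows \<open>C i\<close>.\<close>
  define Y where "Y = vcat m (map (\<lambda>i. K i * const_mat (C i)) (sorted_list_of_set V))"
  define X where "X = hcat m (map (\<lambda>i. const_mat (- B i) * K i) (sorted_list_of_set VC))"
  have BcV: "const_mat (- B i) \<in> carrier_mat m (q i)" and CcV: "const_mat (C i) \<in> carrier_mat (r i) m"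
    if "i \<in> {1..v}" for i using B[OF that] C[OF that] by auto
  have inV: "i \<in> {1..v}" if "i \<in> set (sorted_list_of_set V)" for i using that V fin by auto
  have inVC: "i \<in> {1..v}" if "i \<in> set (sorted_list_of_set VC)" for i using that VC fin by auto
  have Y: "Y \<in> carrier_mat p m"
    unfolding Y_def p_def by (rule vcat_carrier) (rule mult_carrier_mat[OF K CcV[OF inV]])
  have X: "X \<in> carrier_mat m s"
    unfolding X_def s_def by (rule hcat_carrier) (rule mult_carrier_mat[OF BcV[OF inVC] K])
  have "BV = hcat m (map (\<lambda>i. const_mat (- B i)) (sorted_list_of_set V))"
    unfolding BV_def sub_B_eq(1)[OF V]
    by (rule map_mat_hcat[of const_rat _ _ _ q]) (use B inV in auto)
  then have BY: "BV * Y = mat_sum m m (\<lambda>i. const_mat (- B i) * (K i * const_mat (C i))) V"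
    unfolding Y_def using hcat_mult_vcat[of "sorted_list_of_set V" "\<lambda>i. const_mat (- B i)" m q "\<lambda>i. K i * const_mat (C i)" m]
      BcV[OF inV] mult_carrier_mat[OF K CcV[OF inV]] fin by simp
  have "CV = vcat m (map (\<lambda>i. const_mat (C i)) (sorted_list_of_set VC))"
    unfolding CV_def sub_C_def
    by (rule map_mat_vcat[of const_rat _ _ r]) (use C inVC in auto)
  then have XC: "X * CV = mat_sum m m (\<lambda>i. const_mat (- B i) * K i * const_mat (C i)) VC"
    unfolding X_def using hcat_mult_vcat[of "sorted_list_of_set VC" "\<lambda>i. const_mat (- B i) * K i" m r "\<lambda>i. const_mat (C i)" m]
      CcV[OF inVC] mult_carrier_mat[OF BcV[OF inVC] K] fin by simp
  have "G_cn m v q r A B C (const_rat l) = const_mat M + BV * Y + X * CV"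
  proof (rule eq_matI, goal_cases)
    case (1 a b)
    then have ab: "a < m" "b < m" using CV X by auto
    note neg = index_neg_gain_term[OF _ K ab]
    have "(BV * Y) $$ (a, b) + (X * CV) $$ (a, b) =
        (\<Sum>i\<in>V. (const_mat (- B i) * K i * const_mat (C i)) $$ (a, b)) +
        (\<Sum>i\<in>VC. (const_mat (- B i) * K i * const_mat (C i)) $$ (a, b))"
      unfolding BY XC mat_sum_def using ab V
      by (auto intro!: sum.cong simp: assoc_mult_mat[OF BcV K CcV] subset_iff)
    also have "\<dots> = (\<Sum>i\<in>{1..v}. (const_mat (- B i) * K i * const_mat (C i)) $$ (a, b))"
      unfolding VC_def by (subst sum.subset_diff[OF V finite_atLeastAtMost]) (rule add.commute)
    also have "\<dots> = - (\<Sum>i\<in>{1..v}. (const_mat (B i) * K i * const_mat (C i)) $$ (a, b))"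
      by (simp add: neg sum_negf)
    finally have sum: "(BV * Y) $$ (a, b) + (X * CV) $$ (a, b) = \<dots>" .
    have "(const_mat M + BV * Y + X * CV) $$ (a, b) = const_mat M $$ (a, b) + ((BV * Y) $$ (a, b) + (X * CV) $$ (a, b))"
      using ab M BV CV X Y by (simp del: index_mult_mat(1) add: add.assoc)
    also have "\<dots> = G_cn m v q r A B C (const_rat l) $$ (a, b)"
      unfolding sum G_cn_def mat_sum_def K_def using ab A
      by (simp del: index_mult_mat(1) add: M_def cr.hom_minus cr.hom_mult)
    finally show ?case by simp
  qed (use A M CV X in \<open>auto simp: G_cn_def mat_sum_def\<close>)
  moreover have "const_mat (pencil m v A B C l V) = four_block_mat (const_mat M) BV CV (0\<^sub>m s p)"
    unfolding pencil_eq[OF V] BV_def CV_def s_def p_def VC_def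
    using M sub_B_eq(2)[OF V] sub_C_carrier[OF Diff_subset, of V]
    by (subst map_four_block_mat[of _ m m _ p _ s]) (auto simp: s_def p_def VC_def)
  moreover have "mrank (const_mat M + BV * Y + X * CV) \<le> mrank (four_block_mat (const_mat M) BV CV (0\<^sub>m s p))"
    by (rule mrank_bordered_ge[OF _ BV CV X Y]) (use M in simp)
  ultimately show ?thesis using mrank_const_mat_le[of "pencil m v A B C l V"] by simp
qed

section \<open>Transfer matrix and cuts of the network\<close>

abbreviation N :: lti_network where "N \<equiv> N_cn m v q r A B C l"

lemma N_simps [simp]:
  "num_relays N = v" "out_dim N Tx = m" "out_dim N (Relay i) = q i" "in_dim N (Relay i) = r i" "in_dim N Rx = m"
  "channel N Tx Rx = M" "channel N Tx (Relay k) = C k" "channel N (Relay k) Rx = - B k"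
  "channel N (Relay j) (Relay k) = 0\<^sub>m (r k) (q j)"
  by (simp_all add: N_cn_def Let_def M_def)

lemma relay_loop_eq: "relay_loop N = 0\<^sub>m (\<Sum>i\<leftarrow>[1..<Suc v]. r i) (\<Sum>i\<leftarrow>[1..<Suc v]. r i)"
proof -
  interpret cr: comm_ring_hom const_rat by (rule const_rat_hom)
  have zero: "const_mat (0\<^sub>m a b) * gain b c i = 0\<^sub>m a c" for a b c i
  proof -
    have "const_mat (0\<^sub>m a b) = 0\<^sub>m a b" by (rule eq_matI) auto
    then show ?thesis by (simp add: gain_def)
  qed
  define ks where "ks = [1..<Suc v]"
  have "relay_loop N = vcat (\<Sum>i\<leftarrow>ks. r i) (map (\<lambda>k. hcat (r k) (map (\<lambda>j. 0\<^sub>m (r k) (r j)) ks)) ks)"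
    unfolding relay_loop_def block_mat_def relay_list_def N_simps ks_def[symmetric]
    by (simp add: comp_def zero)
  then show ?thesis by (simp add: hcat_zero vcat_zero ks_def)
qed

text \<open>Without channels between relays the loop is zero and the inverse is the identity; what
  remains is the direct channel plus the sum over the two-hop paths through the relays.\<close>

lemma transfer_matrix_eq: "transfer_matrix N = G_cn m v q r A B C (const_rat l)"
proof -
  interpret cr: comm_ring_hom const_rat by (rule const_rat_hom)
  define R where "R = (\<Sum>i\<leftarrow>[1..<Suc v]. r i)"
  define K where "K = (\<lambda>i. gain (q i) (r i) i)"
  have K: "K i \<in> carrier_mat (q i) (r i)" for i by (simp add: K_def gain_def)
  define X where "X = hcat m (map (\<lambda>i. const_mat (- B i) * K i) [1..<Suc v])"
  define Y where "Y = vcat m (map (\<lambda>i. const_mat (C i)) [1..<Suc v])"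
  have in_v: "i \<in> {1..v}" if "i \<in> set [1..<Suc v]" for i using that by auto
  have BK: "const_mat (- B i) * K i \<in> carrier_mat m (r i)" if "i \<in> set [1..<Suc v]" for i
    using B[OF in_v[OF that]] K by auto
  have Cc: "const_mat (C i) \<in> carrier_mat (r i) m" if "i \<in> set [1..<Suc v]" for i
    using C[OF in_v[OF that]] by auto
  have X: "X \<in> carrier_mat m R" unfolding X_def R_def by (rule hcat_carrier[OF BK])
  have XY: "X * Y = mat_sum m m (\<lambda>i. const_mat (- B i) * K i * const_mat (C i)) (set [1..<Suc v])"
    unfolding X_def Y_def by (rule hcat_mult_vcat[OF distinct_upt BK Cc])
  have set: "set [1..<Suc v] = {1..v}" by auto
  have one: "1\<^sub>m R - 0\<^sub>m R R = (1\<^sub>m R :: crat mat)" by (rule eq_matI) auto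
  have "transfer_matrix N = const_mat M + X * 1\<^sub>m R * Y"
    unfolding transfer_matrix_def relay_loop_eq R_def[symmetric] relay_list_def N_simps
    by (simp add: one mat_inverse_one X_def Y_def K_def comp_def del: upt_Suc)
  also have "\<dots> = const_mat M + X * Y" using X by simp
  also have "\<dots> = G_cn m v q r A B C (const_rat l)"
  proof (rule eq_matI, goal_cases)
    case (1 a b)
    then have ab: "a < m" "b < m" by (auto simp: G_cn_def mat_sum_def)
    note neg = index_neg_gain_term[OF _ K ab]
    have "(X * Y) $$ (a, b) = - (\<Sum>i\<in>{1..v}. (const_mat (B i) * K i * const_mat (C i)) $$ (a, b))"
      unfolding XY set mat_sum_def using ab by (simp add: neg sum_negf)
    then show ?case
      unfolding G_cn_def mat_sum_def K_def using ab A X M XY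
      by (simp del: index_mult_mat(1) add: M_def cr.hom_minus cr.hom_mult mat_sum_def)
  qed (use A M XY in \<open>auto simp: G_cn_def mat_sum_def\<close>)
  finally show ?thesis .
qed

text \<open>\<open>Tx\<close> and the relays in \<open>V\<close> transmit \<open>M\<close> and
  \<open>- B_V\<close> to \<open>Rx\<close>. The relays outside \<open>V\<close> receive the rows
  \<open>C i\<close> from \<open>Tx\<close> and nothing from other relays.\<close>

lemma mrank_cut_matrix_eq:
  assumes V: "V \<subseteq> {1..v}"
  shows "mrank (cut_matrix N (insert Tx (Relay ` V))) = mrank (pencil m v A B C l V)"
proof -
  have fin: "finite V" using V finite_subset by auto
  define vs where "vs = sorted_list_of_set V"
  define js where "js = sorted_list_of_set ({1..v} - V)"
  define W where "W = insert Tx (Relay ` V)"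
  have W: "Relay k \<in> W \<longleftrightarrow> k \<in> V" "Tx \<in> W" "Rx \<notin> W" for k by (auto simp: W_def)
  \<comment> \<open>\<open>[1..<Suc v]\<close> is increasing, so filtering it yields the order of
    \<open>sorted_list_of_set\<close> used in the pencil.\<close>
  have "filter (\<lambda>k. k \<in> V) [1..<Suc v] = vs"
    unfolding vs_def using V fin
    by (intro sorted_distinct_set_unique) (auto simp: sorted_wrt_filter simp del: upt_Suc)
  then have cols: "filter (\<lambda>n. n \<in> W) (node_list N) = Tx # map Relay vs"
    by (simp add: W node_list_def relay_list_def filter_map comp_def del: upt_Suc)
  have "filter (\<lambda>k. k \<notin> V) [1..<Suc v] = js"
    unfolding js_def by (intro sorted_distinct_set_unique) (auto simp: sorted_wrt_filter simp del: upt_Suc)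
  then have rows: "filter (\<lambda>n. n \<notin> W) (node_list N) = map Relay js @ [Rx]"
    by (simp add: W node_list_def relay_list_def filter_map comp_def del: upt_Suc)
  define p where "p = (\<Sum>i\<leftarrow>vs. q i)"
  define s where "s = (\<Sum>i\<leftarrow>js. r i)"
  have BV: "- sub_B m B V = hcat m (map (\<lambda>i. - B i) vs)" "- sub_B m B V \<in> carrier_mat m p"
    using sub_B_eq[OF V] by (simp_all add: vs_def p_def)
  have CV: "sub_C m C ({1..v} - V) = vcat m (map C js)" "sub_C m C ({1..v} - V) \<in> carrier_mat s m"
    using sub_C_carrier[OF Diff_subset, of V] by (simp_all add: js_def s_def sub_C_def)
  have "cut_matrix N W = vcat (m + p) (map (\<lambda>k. append_cols (C k) (0\<^sub>m (r k) p)) js @ [append_cols M (- sub_B m B V)])"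
    unfolding cut_matrix_def block_mat_def cols rows
    by (simp add: comp_def hcat_zero BV p_def)
  also have "\<dots> = four_block_mat (vcat m (map C js)) (0\<^sub>m s p) M (- sub_B m B V)"
    unfolding s_def by (rule vcat_bordered) (use C M BV(2) in \<open>auto simp: js_def\<close>)
  also have "mrank \<dots> = mrank (four_block_mat M (- sub_B m B V) (vcat m (map C js)) (0\<^sub>m s p))"
    by (rule mrank_swap_blocks[OF M BV(2)]) (use CV in auto)
  also have "\<dots> = mrank (pencil m v A B C l V)"
    unfolding pencil_eq[OF V] CV(1) by (simp add: vs_def js_def s_def p_def)
  finally show ?thesis by (simp add: W_def)
qed

lemma mincut_rank_eq: "mincut_rank N = Min ((\<lambda>V. mrank (pencil m v A B C l V)) ` Pow {1..v})"
proof -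
  have nodes: "set (node_list N) = insert Tx (insert Rx (Relay ` {1..v}))"
    by (auto simp: node_list_def relay_list_def simp del: upt_Suc)
  have "{W. W \<subseteq> set (node_list N) \<and> Tx \<in> W \<and> Rx \<notin> W} = (\<lambda>V. insert Tx (Relay ` V)) ` Pow {1..v}"
  proof (intro equalityI subsetI)
    fix W assume "W \<in> {W. W \<subseteq> set (node_list N) \<and> Tx \<in> W \<and> Rx \<notin> W}"
    then have W: "W \<subseteq> insert Tx (insert Rx (Relay ` {1..v}))" "Tx \<in> W" "Rx \<notin> W"
      by (auto simp: nodes)
    let ?V = "{i \<in> {1..v}. Relay i \<in> W}"
    have "W = insert Tx (Relay ` ?V)" using W by auto
    then show "W \<in> (\<lambda>V. insert Tx (Relay ` V)) ` Pow {1..v}" by (intro image_eqI[of _ _ ?V]) auto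
  qed (auto simp: nodes)
  then have "(\<lambda>W. mrank (cut_matrix N W)) ` {W. W \<subseteq> set (node_list N) \<and> Tx \<in> W \<and> Rx \<notin> W} =
      (\<lambda>V. mrank (cut_matrix N (insert Tx (Relay ` V)))) ` Pow {1..v}"
    by (simp add: image_image)
  also have "\<dots> = (\<lambda>V. mrank (pencil m v A B C l V)) ` Pow {1..v}"
    by (intro image_cong refl) (simp only: Pow_iff mrank_cut_matrix_eq)
  finally show ?thesis by (simp add: mincut_rank_def)
qed

text \<open>The step from (2) to (1), by contraposition: gains with a nonzero closed-loop
  determinant prevent the polynomial determinant from vanishing.\<close>

lemma not_fixed_mode_imp_G_cn_full_rank:
  assumes "\<not> fixed_mode m v q r A B C l"
  shows "m \<le> mrank (G_cn m v q r A B C (const_rat l))"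
proof -
  have "G_cn m v q r A B C (const_rat l) \<in> carrier_mat m m"
    unfolding G_cn_def mat_sum_def by (rule minus_carrier_mat) simp
  moreover obtain K where K: "\<And>i. i \<in> {1..v} \<Longrightarrow> K i \<in> carrier_mat (q i) (r i)"
    and "det (l \<cdot>\<^sub>m 1\<^sub>m m - A - mat_sum m m (\<lambda>i. B i * K i * C i) {1..v}) \<noteq> 0"
    using assms unfolding fixed_mode_iff_det[OF A] by blast
  then have "det (G_cn m v q r A B C (const_rat l)) \<noteq> 0"
    using det_G_cn_zero_imp_det_zero[of A m v B q C r K l, OF A B C K] by blast
  ultimately show ?thesis using mrank_eq_dim_iff_det by blast
qed

end

theorem theorem7:
  fixes m v :: nat and q r :: "nat \<Rightarrow> nat"
    and A :: "complex mat" and B C :: "nat \<Rightarrow> complex mat" and l :: complex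
  assumes A: "A \<in> carrier_mat m m"
    and B: "\<And>i. i \<in> {1..v} \<Longrightarrow> B i \<in> carrier_mat m (q i)"
    and C: "\<And>i. i \<in> {1..v} \<Longrightarrow> C i \<in> carrier_mat (r i) m"
  shows "(fixed_mode m v q r A B C l
            \<longleftrightarrow> mrank (G_cn m v q r A B C (const_rat l)) < m)
       \<and> (mrank (G_cn m v q r A B C (const_rat l)) < m
            \<longleftrightarrow> mrank (transfer_matrix (N_cn m v q r A B C l)) < m)
       \<and> (mrank (transfer_matrix (N_cn m v q r A B C l)) < m
            \<longleftrightarrow> mincut_rank (N_cn m v q r A B C l) < m)
       \<and> (mincut_rank (N_cn m v q r A B C l) < m
            \<longleftrightarrow> Min ((\<lambda>V. mrank (pencil m v A B C l V)) ` Pow {1..v}) < m)"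
proof -
  interpret decentralized_system m v q r A B C l
    using A B C by unfold_locales
  let ?G = "G_cn m v q r A B C (const_rat l)"
  let ?min = "Min ((\<lambda>V. mrank (pencil m v A B C l V)) ` Pow {1..v})"
  have 1: "?min < m" if "fixed_mode m v q r A B C l"
  proof (rule ccontr)
    assume "\<not> ?min < m"
    then have "m \<le> ?min" by (rule leI)
    moreover have "?min \<le> mrank (pencil m v A B C l V)" if "V \<subseteq> {1..v}" for V
      using that by (intro Min_le) auto
    ultimately have "m \<le> mrank (pencil m v A B C l V)" if "V \<subseteq> {1..v}" for V
      using that le_trans by blast
    then show False using pencils_full_rank_imp_not_fixed_mode that by blast
  qed
  have 2: "mrank ?G < m" if "?min < m"
  proof -
    have "?min \<in> (\<lambda>V. mrank (pencil m v A B C l V)) ` Pow {1..v}" by (intro Min_in) auto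
    then obtain V where "V \<subseteq> {1..v}" "?min = mrank (pencil m v A B C l V)" by auto
    with mrank_G_cn_le_pencil[of V] \<open>?min < m\<close> show ?thesis by simp
  qed
  have 3: "fixed_mode m v q r A B C l" if "mrank ?G < m"
    using not_fixed_mode_imp_G_cn_full_rank that by fastforce
  \<comment> \<open>The implications close the cycle (1), (5), (2), (1); the rewriting identifies
    (3) with (2) and (4) with (5).\<close>
  show ?thesis using 1 2 3 unfolding transfer_matrix_eq mincut_rank_eq by blast
qed

end
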